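(* Let $T$ be a tree on $n\ge 4$ vertices, let $v_1$ and $v_c$ be two non-adjacent vertices of $T$, let $v_1,v_2,\dots,v_c$ be the unique path in $T$ from $v_1$ to $v_c$ (so $c\ge3$), and let $G$ be the graph obtained from $T$ by adding the edge $v_1v_c$. Then $$\begin{aligned}\mathcal{K}(G)-\mathcal{K}(T)\le \frac{1}{4cn(n-1)}\Big\{&4c\cdot\tfrac{2}{3}(n-c+1)(n-c)(n-c-1)\\ &-8(n-c)\Big(-nc\left\lfloor\tfrac{c+1}{2}\right\rfloor\left\lceil\tfrac{c+1}{2}\right\rceil+\tfrac{c(c+1)}{6}\big((2n+1)c+n-1\big)\Big)\\ &-\tfrac{4(n+1)c^2(c^2-1)}{6}+4n(n-1)c(c-1)+2(n-1)c^2\Big\}.\end{aligned}$$ Moreover, equality holds if and only if $T$ is the tree obtained by identifying an end vertex of a path on $n-c+1$ vertices with the middle vertex (or one of the two middle vertices if $c$ is even) of the path $v_1,v_2,\dots,v_c$.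
   Context: Kemeny's constant: for a connected graph $H$ with adjacency matrix $A$ and diagonal degree matrix $\Delta$, consider the random walk with transition matrix $\Delta^{-1}A$, its stationary distribution $w=(w_k)$ and mean first passage times $m_{j,k}$; then $\mathcal{K}(H)=\sum_{k\neq j} m_{j,k}w_k$, which is independent of $j$. *)

theory Defs
  imports Complex_Main
begin

definition simple_graph :: "'a set \<Rightarrow> 'a set set \<Rightarrow> bool" where
  "simple_graph V E \<longleftrightarrow> finite V \<and>
     (\<forall>e\<in>E. \<exists>x y. e = {x, y} \<and> x \<noteq> y \<and> x \<in> V \<and> y \<in> V)"

definition adj :: "'a set set \<Rightarrow> 'a \<Rightarrow> 'a \<Rightarrow> bool" where
  "adj E x y \<longleftrightarrow> x \<noteq> y \<and> {x, y} \<in> E"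

definition degree :: "'a set \<Rightarrow> 'a set set \<Rightarrow> 'a \<Rightarrow> nat" where
  "degree V E x = card {y \<in> V. adj E x y}"

definition is_path :: "'a set \<Rightarrow> 'a set set \<Rightarrow> 'a list \<Rightarrow> bool" where
  "is_path V E ps \<longleftrightarrow> ps \<noteq> [] \<and> distinct ps \<and> set ps \<subseteq> V \<and>
     (\<forall>i. Suc i < length ps \<longrightarrow> adj E (ps ! i) (ps ! Suc i))"

definition connected_graph :: "'a set \<Rightarrow> 'a set set \<Rightarrow> bool" where
  "connected_graph V E \<longleftrightarrow>
     (\<forall>x\<in>V. \<forall>y\<in>V. \<exists>ps. is_path V E ps \<and> hd ps = x \<and> last ps = y)"

definition acyclic_graph :: "'a set \<Rightarrow> 'a set set \<Rightarrow> bool" where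
  "acyclic_graph V E \<longleftrightarrow>
     \<not> (\<exists>ps. is_path V E ps \<and> length ps \<ge> 3 \<and> adj E (last ps) (hd ps))"

definition tree :: "'a set \<Rightarrow> 'a set set \<Rightarrow> bool" where
  "tree V E \<longleftrightarrow> simple_graph V E \<and> V \<noteq> {} \<and> connected_graph V E \<and> acyclic_graph V E"

definition trans :: "'a set \<Rightarrow> 'a set set \<Rightarrow> 'a \<Rightarrow> 'a \<Rightarrow> real" where
  "trans V E x y = (if adj E x y then 1 / real (degree V E x) else 0)"

text \<open>first_passage V E t j k = probability that the walk started at j
  reaches k for the first time at step t+1.\<close>
fun first_passage :: "'a set \<Rightarrow> 'a set set \<Rightarrow> nat \<Rightarrow> 'a \<Rightarrow> 'a \<Rightarrow> real" where
  "first_passage V E 0 j k = trans V E j k"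
| "first_passage V E (Suc t) j k =
     (\<Sum>l\<in>V - {k}. trans V E j l * first_passage V E t l k)"

definition mfpt :: "'a set \<Rightarrow> 'a set set \<Rightarrow> 'a \<Rightarrow> 'a \<Rightarrow> real" where
  "mfpt V E j k = (\<Sum>t. real (Suc t) * first_passage V E t j k)"

text \<open>Stationary distribution of the walk (unique for connected graphs).\<close>
definition stationary :: "'a set \<Rightarrow> 'a set set \<Rightarrow> 'a \<Rightarrow> real" where
  "stationary V E = (THE w. (\<forall>k\<in>V. w k \<ge> 0) \<and> (\<forall>k. k \<notin> V \<longrightarrow> w k = 0) \<and>
      sum w V = 1 \<and> (\<forall>k\<in>V. (\<Sum>j\<in>V. w j * trans V E j k) = w k))"

definition kemeny :: "'a set \<Rightarrow> 'a set set \<Rightarrow> real" where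
  "kemeny V E = (let j = (SOME j. j \<in> V) in
      \<Sum>k\<in>V - {j}. mfpt V E j k * stationary V E k)"

definition path_edges :: "'a list \<Rightarrow> 'a set set" where
  "path_edges xs = {{xs ! i, xs ! Suc i} | i. Suc i < length xs}"

end

theory Submission
  imports Defs
begin

text \<open>If \<open>R\<close> is the effective resistance, then \<open>m j k = (\<Sum>l. deg l * (R j k + R k l - R j l)) / 2\<close>,
  because this solves the hitting-time equations; hence \<open>K = (\<Sum>k l. deg k * deg l * R k l) / (2 * vol)\<close>
  with \<open>vol\<close> the sum of the degrees.
  In a tree \<open>R\<close> is the distance; closing the path of \<open>c\<close> vertices to a cycle subtracts \<open>(i - j)\<^sup>2 / c\<close>
  for vertices in the branches at the \<open>i\<close>-th and the \<open>j\<close>-th path vertex.  Writing \<open>a x y\<close> for the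
  number of common ancestors of \<open>x\<close> and \<open>y\<close> off the path, one finds that \<open>n (n - 1) (K G - K T)\<close> is,
  up to a constant depending on \<open>n\<close> and \<open>c\<close>, the sum over ordered pairs \<open>x \<noteq> y\<close> of
  \<open>2 * a x y - \<bar>i - j\<bar> - (n - 1) / c * (i - j)\<^sup>2\<close>.

  Keep the coefficient \<open>n\<close> in this expression fixed and build the tree from its path leaf by leaf.
  If \<open>t\<close> vertices off the path are present, attaching a leaf to \<open>y\<close> in branch \<open>i\<close> raises the sum by
  \<open>4 * (\<Sum>z. a y z) - 2 * (\<Sum>z. w i (branch z))\<close> with \<open>w i j = \<bar>i - j\<bar> + (n - 1) / c * (i - j)\<^sup>2\<close>.
  The first sum is at most \<open>0 + 1 + \<dots> + t\<close>, and the second at least \<open>\<Sum>j<c. w i j\<close>, which is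
  smallest for \<open>i\<close> in the middle.  Both bounds are attained in every step exactly if each leaf is attached
  to the previous one and the first one to a middle vertex.\<close>

section \<open>Mean first passage times\<close>

text \<open>All terms from index \<open>N div 2\<close> up to \<open>N\<close> are at least
  \<open>g N\<close>, so \<open>N * g N\<close> is at most twice a difference of partial sums, which
  tends to zero. This disposes of the boundary term when the mean first passage time is summed by
  parts.\<close>

lemma decreasing_summable_index_times_tendsto_0:
  fixes g :: "nat \<Rightarrow> real"
  assumes "summable g" and dec: "\<And>t. g (Suc t) \<le> g t" and nonneg: "\<And>t. 0 \<le> g t"
  shows "(\<lambda>N. real N * g N) \<longlonglongrightarrow> 0"
proof -
  define S where "S N = (\<Sum>t<N. g t)" for N
  have S: "S \<longlonglongrightarrow> suminf g"
    using assms(1) unfolding S_def by (rule summable_LIMSEQ)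
  have "filterlim (\<lambda>N::nat. N div 2) at_top sequentially"
  proof (subst filterlim_at_top, intro allI)
    fix Z :: nat
    show "\<forall>\<^sub>F N in sequentially. Z \<le> N div 2"
      using eventually_ge_at_top[of "2 * Z"] by eventually_elim linarith
  qed
  then have "(\<lambda>N. S (N div 2)) \<longlonglongrightarrow> suminf g"
    by (rule filterlim_compose[OF S])
  with S have "(\<lambda>N. 2 * (S N - S (N div 2))) \<longlonglongrightarrow> 2 * (suminf g - suminf g)"
    by (intro tendsto_intros)
  then have lim: "(\<lambda>N. 2 * (S N - S (N div 2))) \<longlonglongrightarrow> 0" by simp
  have anti: "g n \<le> g m" if "m \<le> n" for m n
    using lift_Suc_antimono_le[of g, OF dec that] .
  have "real N * g N \<le> 2 * (S N - S (N div 2))" for N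
  proof -
    have "S N - S (N div 2) = (\<Sum>t=N div 2..<N. g t)"
      using sum.atLeastLessThan_concat[of 0 "N div 2" N g]
      by (simp add: S_def atLeast0LessThan)
    moreover have "(\<Sum>t=N div 2..<N. g t) \<ge> (\<Sum>t=N div 2..<N. g N)"
      by (intro sum_mono anti) auto
    moreover have "(\<Sum>t=N div 2..<N. g N) = real (N - N div 2) * g N" by simp
    moreover have "real N / 2 * g N \<le> real (N - N div 2) * g N"
      using nonneg by (intro mult_right_mono) linarith+
    ultimately show ?thesis by simp
  qed
  then show ?thesis
    using nonneg by (intro tendsto_sandwich[OF _ _ tendsto_const lim]) auto
qed

section \<open>Transition and survival probabilities of the random walk\<close>

lemma adj_commute: "adj E x y \<longleftrightarrow> adj E y x"
  by (auto simp: adj_def insert_commute)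

lemma degree_eq_sum: "finite V \<Longrightarrow> real (degree V E x) = (\<Sum>y\<in>V. of_bool (adj E x y))"
  by (simp add: degree_def of_bool_def sum.If_cases Int_def conj_commute)

lemma trans_eq: "trans V E x y = of_bool (adj E x y) / real (degree V E x)"
  by (simp add: trans_def)

lemma trans_nonneg: "trans V E x y \<ge> 0"
  by (simp add: trans_def)

lemma sum_trans:
  assumes "finite V" "degree V E x > 0"
  shows "(\<Sum>y\<in>V. trans V E x y) = 1"
  using assms(2) by (simp add: trans_eq flip: sum_divide_distrib degree_eq_sum[OF assms(1)])

text \<open>The probability that the walk started at \<open>j\<close> avoids \<open>k\<close> during
  its first \<open>t\<close> steps; the start itself is not tested, so \<open>j = k\<close> is
  allowed.\<close>

primrec surv :: "'a set \<Rightarrow> 'a set set \<Rightarrow> 'a \<Rightarrow> nat \<Rightarrow> 'a \<Rightarrow> real" where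
  "surv V E k 0 j = 1"
| "surv V E k (Suc t) j = (\<Sum>l\<in>V - {k}. trans V E j l * surv V E k t l)"

lemma surv_nonneg: "surv V E k t j \<ge> 0"
  by (induction t arbitrary: j) (auto intro!: sum_nonneg mult_nonneg_nonneg trans_nonneg)

lemma first_passage_nonneg: "first_passage V E t j k \<ge> 0"
  by (induction t arbitrary: j) (auto intro!: sum_nonneg mult_nonneg_nonneg trans_nonneg)

lemma first_passage_eq_surv_diff:
  assumes "finite V" "k \<in> V" "\<And>x. x \<in> V \<Longrightarrow> degree V E x > 0" "j \<in> V"
  shows "first_passage V E t j k = surv V E k t j - surv V E k (Suc t) j"
  using assms(4)
proof (induction t arbitrary: j)
  case 0
  then have "(\<Sum>l\<in>V. trans V E j l) = 1" using sum_trans[OF assms(1) assms(3)] by simp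
  then show ?case using assms(1,2) by (simp add: sum_diff1)
next
  case (Suc t)
  have "first_passage V E (Suc t) j k
      = (\<Sum>l\<in>V - {k}. trans V E j l * (surv V E k t l - surv V E k (Suc t) l))"
    using Suc.IH by simp
  also have "\<dots> = surv V E k (Suc t) j - surv V E k (Suc (Suc t)) j"
    by (simp only: surv.simps right_diff_distrib sum_subtractf)
  finally show ?case .
qed

text \<open>The solution \<open>h\<close> is nonnegative, since at a negative minimum it would exceed itself by one;
  hence it dominates the partial sums of the survival probabilities, which makes them summable.\<close>

lemma mfpt_eqI:
  assumes fin: "finite V" and k: "k \<in> V" and deg: "\<And>x. x \<in> V \<Longrightarrow> degree V E x > 0"
    and h: "\<And>j. j \<in> V - {k} \<Longrightarrow> h j = 1 + (\<Sum>l\<in>V - {k}. trans V E j l * h l)"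
    and j: "j \<in> V - {k}"
  shows "mfpt V E j k = h j"
proof -
  define U where "U = V - {k}"
  have finU: "finite U" and jU: "j \<in> U" using fin j by (auto simp: U_def)
  have PU: "(\<Sum>l\<in>U. trans V E i l) \<le> 1" if "i \<in> U" for i
    using sum_trans[OF fin deg, of i] that k fin trans_nonneg[of V E i k]
    by (auto simp: U_def sum_diff1)
  have hU: "h i = 1 + (\<Sum>l\<in>U. trans V E i l * h l)" if "i \<in> U" for i
    using h that by (simp add: U_def)
  have h_nonneg: "h i \<ge> 0" if i: "i \<in> U" for i
  proof -
    obtain z where z: "z \<in> U" "\<And>l. l \<in> U \<Longrightarrow> h z \<le> h l"
      using arg_min_if_finite(1)[OF finU, of h] arg_min_least[OF finU, of _ h] jU by blast
    have "h z \<ge> 0"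
    proof (rule ccontr)
      assume neg: "\<not> h z \<ge> 0"
      have "h z = 1 + (\<Sum>l\<in>U. trans V E z l * h l)" by (rule hU) (rule z)
      also have "\<dots> \<ge> 1 + (\<Sum>l\<in>U. trans V E z l * h z)"
        by (intro add_left_mono sum_mono mult_left_mono z trans_nonneg)
      also have "(\<Sum>l\<in>U. trans V E z l * h z) = (\<Sum>l\<in>U. trans V E z l) * h z"
        by (simp add: sum_distrib_right)
      also have "\<dots> \<ge> 1 * h z"
        using PU[OF z(1)] neg by (intro mult_right_mono_neg) auto
      finally show False by simp
    qed
    then show ?thesis using z(2)[OF i] by simp
  qed
  define s where "s = surv V E k"
  have s0: "s 0 i = 1" for i by (simp add: s_def)
  have sSuc: "s (Suc t) i = (\<Sum>l\<in>U. trans V E i l * s t l)" for t i by (simp add: s_def U_def)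
  have s_nonneg: "s t i \<ge> 0" for t i by (simp add: s_def surv_nonneg)
  have fp: "first_passage V E t i k = s t i - s (Suc t) i" if "i \<in> U" for t i
    unfolding s_def using that by (intro first_passage_eq_surv_diff fin k deg) (auto simp: U_def)
  have s_dec: "s (Suc t) i \<le> s t i" if "i \<in> U" for t i
    using fp[OF that, of t] first_passage_nonneg[of V E t i k] by simp
  \<comment> \<open>Conditioning on the first step: the partial sums satisfy the recursion of
    \<open>h\<close> with the horizon shortened by one.\<close>
  have shift: "(\<Sum>t<Suc N. s t i) = 1 + (\<Sum>l\<in>U. trans V E i l * (\<Sum>t<N. s t l))" for N i
  proof -
    have "(\<Sum>t<Suc N. s t i) = 1 + (\<Sum>t<N. s (Suc t) i)"
      by (subst sum.lessThan_Suc_shift) (simp add: s0)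
    also have "(\<Sum>t<N. s (Suc t) i) = (\<Sum>l\<in>U. trans V E i l * (\<Sum>t<N. s t l))"
      by (simp add: sSuc sum_distrib_left) (rule sum.swap)
    finally show ?thesis .
  qed
  have lower: "(\<Sum>t<N. s t i) \<le> h i" if "i \<in> U" for N i
    using that
  proof (induction N arbitrary: i)
    case (Suc N)
    have "(\<Sum>l\<in>U. trans V E i l * (\<Sum>t<N. s t l)) \<le> (\<Sum>l\<in>U. trans V E i l * h l)"
      by (intro sum_mono mult_left_mono Suc.IH trans_nonneg)
    then show ?case using shift[of i N] hU[OF Suc.prems] by linarith
  qed (simp add: h_nonneg)
  define C where "C = (\<Sum>l\<in>U. h l)"
  have hC: "h i \<le> C" if "i \<in> U" for i
    unfolding C_def using that finU h_nonneg by (intro member_le_sum) auto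
  \<comment> \<open>Truncating at \<open>N\<close> loses at most the probability of surviving that
    long times the bound \<open>C\<close> on the remaining expectation.\<close>
  have upper: "h i \<le> (\<Sum>t<N. s t i) + C * s N i" if "i \<in> U" for N i
    using that
  proof (induction N arbitrary: i)
    case (Suc N)
    have "h i = 1 + (\<Sum>l\<in>U. trans V E i l * h l)" by (rule hU) (rule Suc.prems)
    also have "(\<Sum>l\<in>U. trans V E i l * h l)
        \<le> (\<Sum>l\<in>U. trans V E i l * ((\<Sum>t<N. s t l) + C * s N l))"
      by (intro sum_mono mult_left_mono Suc.IH trans_nonneg)
    also have "\<dots> = (\<Sum>l\<in>U. trans V E i l * (\<Sum>t<N. s t l)) + C * s (Suc N) i"
      unfolding sSuc sum_distrib_left[of C] sum.distrib[symmetric]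
      by (intro sum.cong refl) (simp add: algebra_simps)
    finally show ?case using shift[of i N] by linarith
  qed (simp add: s0 hC)
  have summ: "summable (\<lambda>t. s t j)"
    using s_nonneg lower[OF jU] by (intro summableI_nonneg_bounded)
  have s_lim: "(\<lambda>N. s N j) \<longlonglongrightarrow> 0" using summ by (rule summable_LIMSEQ_zero)
  have S_lim: "(\<lambda>N. \<Sum>t<N. s t j) \<longlonglongrightarrow> h j"
  proof (rule tendsto_sandwich)
    show "(\<lambda>N. h j - C * s N j) \<longlonglongrightarrow> h j"
      using tendsto_diff[OF tendsto_const[of "h j"] tendsto_mult_left[OF s_lim, of C]] by simp
    show "\<forall>\<^sub>F N in sequentially. h j - C * s N j \<le> (\<Sum>t<N. s t j)"
      using upper[OF jU] by (intro always_eventually allI) (smt (verit))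
    show "\<forall>\<^sub>F N in sequentially. (\<Sum>t<N. s t j) \<le> h j"
      using lower[OF jU] by simp
  qed (rule tendsto_const)
  \<comment> \<open>Summation by parts; the index shift in \<open>first_passage\<close> makes the
    weight of step \<open>t + 1\<close> equal to \<open>Suc t\<close>.\<close>
  have "(\<Sum>t<N. real (Suc t) * first_passage V E t j k) = (\<Sum>t<N. s t j) - real N * s N j" for N
    by (induction N) (simp_all add: fp[OF jU] algebra_simps)
  moreover have "(\<lambda>N. real N * s N j) \<longlonglongrightarrow> 0"
    using summ s_dec[OF jU] s_nonneg by (rule decreasing_summable_index_times_tendsto_0)
  ultimately have "(\<lambda>t. real (Suc t) * first_passage V E t j k) sums h j"
    unfolding sums_def using tendsto_diff[OF S_lim] by fastforce
  then show ?thesis unfolding mfpt_def by (rule sums_unique[symmetric])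
qed

section \<open>Kemeny's constant and effective resistance\<close>

definition lap :: "'a set \<Rightarrow> 'a set set \<Rightarrow> ('a \<Rightarrow> real) \<Rightarrow> 'a \<Rightarrow> real" where
  "lap V E u x = (\<Sum>y\<in>V. of_bool (adj E x y) * (u x - u y))"

lemma lap_degree:
  "finite V \<Longrightarrow> lap V E u x = real (degree V E x) * u x - (\<Sum>y\<in>V. of_bool (adj E x y) * u y)"
  by (simp add: lap_def degree_eq_sum right_diff_distrib sum_subtractf sum_distrib_right)

lemma lap_cong: "(\<And>y. y \<in> V \<Longrightarrow> u y = v y) \<Longrightarrow> x \<in> V \<Longrightarrow> lap V E u x = lap V E v x"
  by (simp add: lap_def)

lemma lap_diff: "lap V E (\<lambda>x. u x - v x) x = lap V E u x - lap V E v x"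
  by (simp add: lap_def algebra_simps flip: sum_subtractf)

lemma lap_add: "lap V E (\<lambda>x. u x + v x) x = lap V E u x + lap V E v x"
  by (simp add: lap_def algebra_simps flip: sum.distrib)

lemma lap_cmult: "lap V E (\<lambda>x. c * u x) x = c * lap V E u x"
  by (simp add: lap_def sum_distrib_left algebra_simps)

lemma lap_const [simp]: "lap V E (\<lambda>_. c) x = 0"
  by (simp add: lap_def)

lemma lap_sum: "lap V E (\<lambda>x. \<Sum>i\<in>I. u i x) x = (\<Sum>i\<in>I. lap V E (u i) x)"
proof -
  have "lap V E (\<lambda>x. \<Sum>i\<in>I. u i x) x
      = (\<Sum>y\<in>V. \<Sum>i\<in>I. of_bool (adj E x y) * (u i x - u i y))"
    by (simp add: lap_def sum_distrib_left flip: sum_subtractf)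
  also have "\<dots> = (\<Sum>i\<in>I. lap V E (u i) x)"
    unfolding lap_def by (rule sum.swap)
  finally show ?thesis .
qed

text \<open>Green's identity: the degree part is diagonal, and the adjacency part is symmetric under
  exchanging the two summations.\<close>

lemma lap_symmetric:
  assumes "finite V"
  shows "(\<Sum>x\<in>V. v x * lap V E u x) = (\<Sum>x\<in>V. u x * lap V E v x)"
proof -
  have "(\<Sum>x\<in>V. \<Sum>y\<in>V. of_bool (adj E x y) * (v x * u y))
      = (\<Sum>y\<in>V. \<Sum>x\<in>V. of_bool (adj E x y) * (v x * u y))"
    by (rule sum.swap)
  also have "\<dots> = (\<Sum>x\<in>V. \<Sum>y\<in>V. of_bool (adj E x y) * (u x * v y))"
    by (intro sum.cong refl) (simp add: adj_commute mult.commute)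
  finally have "(\<Sum>x\<in>V. v x * (\<Sum>y\<in>V. of_bool (adj E x y) * u y))
      = (\<Sum>x\<in>V. u x * (\<Sum>y\<in>V. of_bool (adj E x y) * v y))"
    by (simp add: sum_distrib_left mult.left_commute)
  then show ?thesis
    by (simp add: lap_degree[OF assms] right_diff_distrib sum_subtractf mult.left_commute
        mult.commute)
qed

text \<open>For the effective resistance \<open>R\<close> of a graph, \<open>(R x k - R x j) / 2\<close> is, up to a constant,
  the potential of a unit current from \<open>j\<close> to \<open>k\<close>; this is what the last condition says.\<close>

definition resistance ::
  "'a set \<Rightarrow> 'a set set \<Rightarrow> ('a \<Rightarrow> real) \<Rightarrow> ('a \<Rightarrow> 'a \<Rightarrow> real) \<Rightarrow> bool" where
  "resistance V E f R \<longleftrightarrow> (\<forall>x\<in>V. R x x = 0) \<and> (\<forall>x\<in>V. \<forall>y\<in>V. R x y = R y x) \<and>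
     (\<forall>x\<in>V. \<forall>k\<in>V. lap V E (\<lambda>y. R y k) x = f x - 2 * of_bool (x = k))"

lemma resistance_cong:
  assumes "resistance V E f R" "\<And>x. x \<in> V \<Longrightarrow> f x = f' x"
    and "\<And>x y. x \<in> V \<Longrightarrow> y \<in> V \<Longrightarrow> R x y = R' x y"
  shows "resistance V E f' R'"
proof -
  have "lap V E (\<lambda>y. R y k) x = lap V E (\<lambda>y. R' y k) x" if "x \<in> V" "k \<in> V" for x k
    using that assms(3) by (intro lap_cong)
  then show ?thesis using assms by (simp add: resistance_def)
qed

text \<open>At an isolated vertex every Laplacian vanishes, which would force \<open>f x = 2\<close>
  from \<open>k = x\<close> and \<open>f x = 0\<close> from any other \<open>k\<close>.\<close>

lemma resistance_degree_pos:
  assumes "resistance V E f R" "finite V" "2 \<le> card V" "x \<in> V"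
  shows "degree V E x > 0"
proof (rule ccontr)
  assume "\<not> degree V E x > 0"
  then have no: "{y \<in> V. adj E x y} = {}" using assms(2) by (simp add: degree_def)
  have "lap V E u x = 0" for u
    unfolding lap_def using no by (intro sum.neutral) auto
  then have f: "f x - 2 * of_bool (x = k) = 0" if "k \<in> V" for k
    using assms(1,4) that unfolding resistance_def by metis
  have "V \<noteq> {x}" using assms(3) by auto
  then obtain k where "k \<in> V" "k \<noteq> x" using assms(4) by blast
  then show False using f[of x] f[of k] assms(4) by simp
qed

text \<open>Green's identity against \<open>R y k - R y j\<close>, whose Laplacian is a dipole at
  \<open>j\<close> and \<open>k\<close>, turns harmonicity of \<open>u\<close> into
  \<open>u j = u k\<close>. The existence of \<open>R\<close> thus takes the place of
  connectivity.\<close>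

lemma harmonic_constant:
  assumes R: "resistance V E f R" and fin: "finite V"
    and harm: "\<And>x. x \<in> V \<Longrightarrow> lap V E u x = 0" and jk: "j \<in> V" "k \<in> V"
  shows "u j = u k"
proof -
  have lapR: "lap V E (\<lambda>y. R y k - R y j) x = 2 * of_bool (x = j) - 2 * of_bool (x = k)"
    if "x \<in> V" for x
    using R that jk by (simp add: lap_diff resistance_def)
  have "0 = (\<Sum>x\<in>V. (R x k - R x j) * lap V E u x)" using harm by simp
  also have "\<dots> = (\<Sum>x\<in>V. u x * lap V E (\<lambda>y. R y k - R y j) x)" by (rule lap_symmetric[OF fin])
  also have "\<dots> = (\<Sum>x\<in>V. (if x = j then 2 * u x else 0) - (if x = k then 2 * u x else 0))"
    by (intro sum.cong refl) (simp add: lapR)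
  also have "\<dots> = 2 * u j - 2 * u k"
    using fin jk by (simp add: sum_subtractf)
  finally show ?thesis by simp
qed

text \<open>The walk is reversible, so a stationary \<open>w\<close> divided by the degree is
  harmonic and hence constant; the normalisation then fixes the constant. This gives the uniqueness
  that the definite description asks for.\<close>

lemma stationary_eq:
  assumes R: "resistance V E f R" and fin: "finite V" and card: "2 \<le> card V"
  shows "stationary V E = (\<lambda>k. if k \<in> V then real (degree V E k) / (\<Sum>l\<in>V. real (degree V E l)) else 0)"
proof -
  define vol where "vol = (\<Sum>l\<in>V. real (degree V E l))"
  have deg: "degree V E x > 0" if "x \<in> V" for x
    using resistance_degree_pos[OF R fin card that] .
  have vol: "vol > 0"
    unfolding vol_def using card fin deg by (intro sum_pos) auto
  show ?thesis
    unfolding stationary_def vol_def[symmetric]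
  proof (rule the_equality, intro conjI ballI allI impI)
    show "sum (\<lambda>k. if k \<in> V then real (degree V E k) / vol else 0) V = 1"
      using vol by (simp add: vol_def flip: sum_divide_distrib)
  next
    fix k assume k: "k \<in> V"
    have "(\<Sum>j\<in>V. (if j \<in> V then real (degree V E j) / vol else 0) * trans V E j k)
        = (\<Sum>j\<in>V. of_bool (adj E k j) / vol)"
      using deg by (intro sum.cong refl) (auto simp: trans_eq adj_commute)
    also have "\<dots> = real (degree V E k) / vol"
      by (simp add: degree_eq_sum[OF fin] sum_divide_distrib)
    finally show "(\<Sum>j\<in>V. (if j \<in> V then real (degree V E j) / vol else 0) * trans V E j k)
        = (if k \<in> V then real (degree V E k) / vol else 0)" using k by simp
  next
    fix w
    assume w: "(\<forall>k\<in>V. 0 \<le> w k) \<and> (\<forall>k. k \<notin> V \<longrightarrow> w k = 0) \<and> sum w V = 1 \<and>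
      (\<forall>k\<in>V. (\<Sum>j\<in>V. w j * trans V E j k) = w k)"
    define u where "u x = w x / real (degree V E x)" for x
    have wu: "w x = real (degree V E x) * u x" if "x \<in> V" for x
      using deg[OF that] by (simp add: u_def)
    have harm: "lap V E u k = 0" if k: "k \<in> V" for k
    proof -
      have "(\<Sum>y\<in>V. of_bool (adj E k y) * u y) = (\<Sum>j\<in>V. w j * trans V E j k)"
        by (intro sum.cong refl) (simp add: trans_eq u_def adj_commute)
      then show ?thesis using w k wu[OF k] by (simp add: lap_degree[OF fin])
    qed
    have const: "u i = u k" if "i \<in> V" "k \<in> V" for i k
      using R fin harm that by (rule harmonic_constant)
    obtain z where z: "z \<in> V" using card by fastforce
    have "1 = (\<Sum>x\<in>V. real (degree V E x) * u z)"
      using w wu const[OF z] by (metis (no_types, lifting) sum.cong)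
    then have "1 = vol * u z" by (simp add: vol_def sum_distrib_right)
    then have uz: "u z = 1 / vol" using vol by (simp add: field_simps)
    show "w = (\<lambda>k. if k \<in> V then real (degree V E k) / vol else 0)"
    proof
      fix k
      show "w k = (if k \<in> V then real (degree V E k) / vol else 0)"
      proof (cases "k \<in> V")
        case True
        then show ?thesis using wu[OF True] const[OF True z] uz by simp
      next
        case False
        then show ?thesis using w by simp
      qed
    qed
  qed (simp_all add: vol_def sum_nonneg)
qed

text \<open>Applied to the right-hand side, the Laplacian at \<open>i \<noteq> k\<close> loses the
  source \<open>f i\<close> by cancellation and keeps only the point term at \<open>l = i\<close>,
  that is the degree of \<open>i\<close>. Divided by the degree, this is the hitting-time
  equation.\<close>

lemma mfpt_eq:
  assumes R: "resistance V E f R" and fin: "finite V" and card: "2 \<le> card V"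
    and jk: "j \<in> V" "k \<in> V" "j \<noteq> k"
  shows "mfpt V E j k = (\<Sum>l\<in>V. real (degree V E l) * (R j k + R k l - R j l)) / 2"
proof -
  define h where "h i = (\<Sum>l\<in>V. real (degree V E l) * (R i k + R k l - R i l)) / 2" for i
  have deg: "degree V E x > 0" if "x \<in> V" for x
    using resistance_degree_pos[OF R fin card that] .
  have hk: "h k = 0"
    using R jk(2) by (simp add: h_def resistance_def)
  have "h i = 1 + (\<Sum>l\<in>V - {k}. trans V E i l * h l)" if i: "i \<in> V - {k}" for i
  proof -
    have lapk: "lap V E (\<lambda>x. R x l) i = f i - 2 * of_bool (i = l)" if "l \<in> V" for l
      using R i that by (simp add: resistance_def)
    have "lap V E h i
        = (\<Sum>l\<in>V. real (degree V E l) / 2 * (lap V E (\<lambda>x. R x k) i - lap V E (\<lambda>x. R x l) i))"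
      unfolding h_def sum_divide_distrib lap_sum
      by (intro sum.cong refl)
         (simp add: lap_cmult lap_diff lap_add mult.commute[of _ "_ / 2"]
           flip: times_divide_eq_left)
    also have "\<dots> = (\<Sum>l\<in>V. if i = l then real (degree V E l) else 0)"
      using i jk by (intro sum.cong refl) (simp add: lapk)
    also have "\<dots> = real (degree V E i)" using i fin by simp
    finally have "real (degree V E i) * h i
        = real (degree V E i) + (\<Sum>y\<in>V. of_bool (adj E i y) * h y)"
      by (simp add: lap_degree[OF fin])
    \<comment> \<open>The target contributes nothing because \<open>h\<close> vanishes
      there.\<close>
    also have "(\<Sum>y\<in>V. of_bool (adj E i y) * h y) = (\<Sum>y\<in>V - {k}. of_bool (adj E i y) * h y)"
      using sum.remove[OF fin jk(2), of "\<lambda>y. of_bool (adj E i y) * h y"] hk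
      by (simp del: sum_mult_of_bool_eq sum_of_bool_mult_eq)
    finally show ?thesis
      using deg[of i] i by (simp add: trans_eq field_simps sum_distrib_left flip: sum_divide_distrib)
  qed
  then show ?thesis
    using mfpt_eqI[OF fin jk(2) deg, of h j] jk by (simp add: h_def)
qed

text \<open>Weighted by the symmetric product of degrees, the terms \<open>R j k\<close> and
  \<open>R j l\<close> have the same double sum and cancel. This removes the starting vertex
  \<open>j\<close>.\<close>

lemma kemeny_eq:
  assumes R: "resistance V E f R" and fin: "finite V" and card: "2 \<le> card V"
  shows "kemeny V E = (\<Sum>k\<in>V. \<Sum>l\<in>V. real (degree V E k) * real (degree V E l) * R k l)
    / (2 * (\<Sum>l\<in>V. real (degree V E l)))"
proof -
  define vol where "vol = (\<Sum>l\<in>V. real (degree V E l))"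
  define d where "d x = real (degree V E x)" for x
  define j where "j = (SOME j. j \<in> V)"
  have j: "j \<in> V" using card unfolding j_def by (metis all_not_in_conv card.empty not_numeral_le_zero someI)
  have vol: "vol > 0"
    unfolding vol_def using card fin resistance_degree_pos[OF R fin card] by (intro sum_pos) auto
  define M where "M k = (\<Sum>l\<in>V. d l * (R j k + R k l - R j l)) / 2" for k
  have Mj: "M j = 0" using R j by (simp add: M_def resistance_def)
  have "kemeny V E = (\<Sum>k\<in>V - {j}. M k * (d k / vol))"
    unfolding kemeny_def Let_def j_def[symmetric]
  proof (intro sum.cong refl)
    fix k assume "k \<in> V - {j}"
    then have "k \<in> V" "j \<noteq> k" by auto
    then show "mfpt V E j k * stationary V E k = M k * (d k / vol)"
      unfolding mfpt_eq[OF R fin card j \<open>k \<in> V\<close> \<open>j \<noteq> k\<close>] stationary_eq[OF R fin card]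
      by (simp only: M_def d_def vol_def if_True)
  qed
  also have "\<dots> = (\<Sum>k\<in>V. M k * (d k / vol))"
    using fin j by (simp add: sum_diff1 Mj)
  also have "\<dots> = (\<Sum>k\<in>V. \<Sum>l\<in>V. d k * d l * (R j k + R k l - R j l)) / (2 * vol)"
    unfolding sum_divide_distrib[of _ V]
  proof (intro sum.cong refl)
    fix k
    have "(\<Sum>l\<in>V. d k * d l * (R j k + R k l - R j l)) = d k * (2 * M k)"
      by (simp add: M_def mult.assoc flip: sum_distrib_left)
    then show "M k * (d k / vol) = (\<Sum>l\<in>V. d k * d l * (R j k + R k l - R j l) / (2 * vol))"
      by (simp flip: sum_divide_distrib)
  qed
  also have "(\<Sum>k\<in>V. \<Sum>l\<in>V. d k * d l * (R j k + R k l - R j l))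
      = (\<Sum>k\<in>V. \<Sum>l\<in>V. d k * d l * R j k) + (\<Sum>k\<in>V. \<Sum>l\<in>V. d k * d l * R k l)
        - (\<Sum>k\<in>V. \<Sum>l\<in>V. d k * d l * R j l)"
    by (simp only: distrib_left right_diff_distrib sum.distrib sum_subtractf)
  also have "(\<Sum>k\<in>V. \<Sum>l\<in>V. d k * d l * R j l) = (\<Sum>l\<in>V. \<Sum>k\<in>V. d k * d l * R j l)"
    by (rule sum.swap)
  also have "\<dots> = (\<Sum>k\<in>V. \<Sum>l\<in>V. d k * d l * R j k)"
    by (simp add: mult.commute)
  finally show ?thesis by (simp add: vol_def d_def)
qed

text \<open>The new edge is a rank-one change of the Laplacian, so the formula is of
  Sherman-Morrison type. Up to scaling, \<open>\<phi>\<close> is the potential of a current between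
  \<open>p\<close> and \<open>q\<close>. The new source is \<open>f\<close> minus the Laplacian of
  \<open>\<phi>\<close> squared, divided by \<open>4 * (1 + R p q)\<close>.\<close>

lemma resistance_add_edge:
  assumes R: "resistance V E f R" and fin: "finite V" and pq: "p \<in> V" "q \<in> V" "p \<noteq> q"
    and new: "\<not> adj E p q" and pos: "R p q > 0"
  defines "\<phi> \<equiv> \<lambda>x. R x p - R x q"
  shows "\<exists>f'. resistance V (insert {p, q} E) f'
    (\<lambda>x y. R x y - (\<phi> x - \<phi> y)\<^sup>2 / (4 * (1 + R p q)))"
proof -
  define r where "r = 1 + R p q"
  have r: "r > 0" using pos by (simp add: r_def)
  have sym: "R x y = R y x" if "x \<in> V" "y \<in> V" for x y
    using R that by (simp add: resistance_def)
  have diag: "R x x = 0" if "x \<in> V" for x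
    using R that by (simp add: resistance_def)
  have lapR: "lap V E (\<lambda>y. R y k) x = f x - 2 * of_bool (x = k)" if "x \<in> V" "k \<in> V" for x k
    using R that by (simp add: resistance_def)
  have adj: "adj (insert {p, q} E) x y \<longleftrightarrow> adj E x y \<or> x = p \<and> y = q \<or> x = q \<and> y = p" for x y
    using pq(3) by (auto simp: adj_def doubleton_eq_iff)
  have new': "\<not> adj E q p" using new adj_commute by metis
  have lap': "lap V (insert {p, q} E) u x
      = lap V E u x + (if x = p then u p - u q else 0) + (if x = q then u q - u p else 0)"
    if "x \<in> V" for u x
  proof -
    have "lap V (insert {p, q} E) u x = (\<Sum>y\<in>V. of_bool (adj E x y) * (u x - u y)
        + (if y = q then if x = p then u p - u q else 0 else 0)
        + (if y = p then if x = q then u q - u p else 0 else 0))"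
      unfolding lap_def using new new' pq(3) by (intro sum.cong refl) (auto simp: adj)
    also have "\<dots> = lap V E u x + (if x = p then u p - u q else 0) + (if x = q then u q - u p else 0)"
      using fin pq by (simp add: sum.distrib lap_def)
    finally show ?thesis .
  qed
  have \<phi>p: "\<phi> p = 1 - r" and \<phi>q: "\<phi> q = r - 1"
    using diag pq sym by (auto simp: \<phi>_def r_def)
  have lap\<phi>: "lap V E \<phi> x = 2 * of_bool (x = q) - 2 * of_bool (x = p)" if "x \<in> V" for x
    unfolding \<phi>_def using lapR that pq by (simp add: lap_diff)
  have main: "lap V (insert {p, q} E) (\<lambda>x. R x k - (\<phi> x - \<phi> k)\<^sup>2 / (4 * r)) x
      = f x - lap V E (\<lambda>x. (\<phi> x)\<^sup>2) x / (4 * r) - 2 * of_bool (x = k)"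
    if x: "x \<in> V" and k: "k \<in> V" for x k
  proof -
    \<comment> \<open>Expanding the square leaves a part that is linear in \<open>\<phi>\<close>,
      whose old Laplacian is a dipole at \<open>p\<close> and \<open>q\<close>.\<close>
    let ?u = "\<lambda>x. R x k - (\<phi> x - \<phi> k)\<^sup>2 / (4 * r)"
    have eq: "?u = (\<lambda>x. R x k - (1 / (4 * r) * (\<phi> x)\<^sup>2 - (\<phi> k / (2 * r)) * \<phi> x
        + (\<phi> k)\<^sup>2 / (4 * r)))"
      using r by (auto simp: fun_eq_iff power2_diff field_simps)
    have "lap V E ?u x = f x - 2 * of_bool (x = k) - lap V E (\<lambda>x. (\<phi> x)\<^sup>2) x / (4 * r)
        + \<phi> k / r * (of_bool (x = q) - of_bool (x = p))"
    proof -
      have "lap V E ?u x = lap V E (\<lambda>x. R x k) x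
          - (1 / (4 * r) * lap V E (\<lambda>x. (\<phi> x)\<^sup>2) x - \<phi> k / (2 * r) * lap V E \<phi> x)"
        unfolding eq lap_diff lap_add lap_cmult lap_const by simp
      then show ?thesis using r by (simp only: lapR[OF x k] lap\<phi>[OF x]) (simp add: field_simps)
    qed
    \<comment> \<open>This is the flow through the new edge; its contributions at \<open>p\<close>
      and \<open>q\<close> cancel the dipole.\<close>
    moreover have "?u p - ?u q = \<phi> k / r"
    proof -
      have "R p k - R q k = \<phi> k" using sym pq k by (simp add: \<phi>_def)
      then show ?thesis unfolding \<phi>p \<phi>q using r by (simp add: power2_eq_square field_simps)
    qed
    ultimately show ?thesis using lap'[OF x, of ?u] pq(3) by auto
  qed
  have "resistance V (insert {p, q} E) (\<lambda>x. f x - lap V E (\<lambda>x. (\<phi> x)\<^sup>2) x / (4 * r))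
      (\<lambda>x y. R x y - (\<phi> x - \<phi> y)\<^sup>2 / (4 * r))"
    unfolding resistance_def using diag sym main by (auto simp: power2_commute)
  then show ?thesis unfolding r_def by blast
qed

text \<open>A pendant unit resistor is in series with everything else. Among the old vertices only
  \<open>y\<close> sees the new edge, and for an old target \<open>k\<close> the potential is higher
  by one at the leaf; this moves the source by one at \<open>y\<close> and gives the leaf source
  one.\<close>

lemma resistance_add_leaf:
  assumes R: "resistance V E f R" and fin: "finite V" and sg: "simple_graph V E"
    and x: "x \<notin> V" and y: "y \<in> V"
    and on: "\<And>u v. u \<in> V \<Longrightarrow> v \<in> V \<Longrightarrow> R' u v = R u v"
    and l: "\<And>v. v \<in> V \<Longrightarrow> R' x v = R y v + 1" and l': "\<And>v. v \<in> V \<Longrightarrow> R' v x = R y v + 1"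
    and "R' x x = 0"
  shows "resistance (insert x V) (insert {x, y} E) (f(y := f y - 1, x := 1)) R'"
proof -
  have xy: "x \<noteq> y" using x y by auto
  have sym: "R u v = R v u" if "u \<in> V" "v \<in> V" for u v
    using R that by (simp add: resistance_def)
  have diag: "R u u = 0" if "u \<in> V" for u
    using R that by (simp add: resistance_def)
  have lapR: "lap V E (\<lambda>y. R y k) x = f x - 2 * of_bool (x = k)" if "x \<in> V" "k \<in> V" for x k
    using R that by (simp add: resistance_def)
  have noE: "\<not> adj E x v" "\<not> adj E v x" for v
    using sg x unfolding adj_def simple_graph_def by (auto simp: doubleton_eq_iff)
  have adj: "adj (insert {x, y} E) u v \<longleftrightarrow> adj E u v \<or> u = x \<and> v = y \<or> u = y \<and> v = x" for u v
    using xy by (auto simp: adj_def doubleton_eq_iff)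
  have lapV: "lap (insert x V) (insert {x, y} E) w u = lap V E w u + (if u = y then w y - w x else 0)"
    if u: "u \<in> V" for w u
  proof -
    have "lap (insert x V) (insert {x, y} E) w u = (if u = y then w y - w x else 0)
        + (\<Sum>v\<in>V. of_bool (adj (insert {x, y} E) u v) * (w u - w v))"
    proof -
      have "of_bool (adj (insert {x, y} E) u x) * (w u - w x) = (if u = y then w y - w x else 0)"
        using u x by (auto simp: adj noE)
      then show ?thesis unfolding lap_def sum.insert[OF fin x] by simp
    qed
    also have "(\<Sum>v\<in>V. of_bool (adj (insert {x, y} E) u v) * (w u - w v)) = lap V E w u"
      unfolding lap_def
    proof (intro sum.cong refl)
      fix v assume "v \<in> V"
      then have "v \<noteq> x" "u \<noteq> x" using x u by blast+
      then show "of_bool (adj (insert {x, y} E) u v) * (w u - w v) = of_bool (adj E u v) * (w u - w v)"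
        unfolding adj by simp
    qed
    finally show ?thesis by (simp only: add.commute)
  qed
  have lapx: "lap (insert x V) (insert {x, y} E) w x = w x - w y" for w
  proof -
    have "lap (insert x V) (insert {x, y} E) w x
        = (\<Sum>v\<in>V. if v = y then w x - w y else 0)"
    proof -
      have "(\<Sum>v\<in>V. of_bool (adj (insert {x, y} E) x v) * (w x - w v))
          = (\<Sum>v\<in>V. if v = y then w x - w y else 0)"
        using xy by (intro sum.cong refl) (simp add: adj noE)
      then show ?thesis unfolding lap_def sum.insert[OF fin x] by simp
    qed
    then show ?thesis using fin y by simp
  qed
  have "lap (insert x V) (insert {x, y} E) (\<lambda>v. R' v k) u
      = (f(y := f y - 1, x := 1)) u - 2 * of_bool (u = k)"
    if u: "u \<in> insert x V" and k: "k \<in> insert x V" for u k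
  proof (cases "u = x")
    case True
    then show ?thesis
      using k x y xy assms(9) by (auto simp: lapx on l l' diag)
  next
    case False
    then have u: "u \<in> V" using u by simp
    show ?thesis
    proof (cases "k = x")
      case True
      have "lap V E (\<lambda>v. R' v k) u = lap V E (\<lambda>v. R v y + 1) u"
        using True y by (intro lap_cong u) (simp add: l' sym)
      then show ?thesis
        using True u y x xy False assms(9) by (auto simp: lapV lap_add lapR l' diag)
    next
      case kx: False
      then have k: "k \<in> V" using k by simp
      have "lap V E (\<lambda>v. R' v k) u = lap V E (\<lambda>v. R v k) u"
        using k by (intro lap_cong u) (simp add: on)
      then show ?thesis
        using u y x xy False k by (auto simp: lapV lapR l on)
    qed
  qed
  then show ?thesis
    unfolding resistance_def using on l l' diag sym assms(9) by auto
qed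

section \<open>Trees grown from a path\<close>

lemma path_edges_snoc:
  assumes "ps \<noteq> []"
  shows "path_edges (ps @ [x]) = insert {x, last ps} (path_edges ps)"
proof
  show "path_edges (ps @ [x]) \<subseteq> insert {x, last ps} (path_edges ps)"
  proof
    fix e assume "e \<in> path_edges (ps @ [x])"
    then obtain i where i: "Suc i < Suc (length ps)" "e = {(ps @ [x]) ! i, (ps @ [x]) ! Suc i}"
      by (auto simp: path_edges_def)
    show "e \<in> insert {x, last ps} (path_edges ps)"
    proof (cases "Suc i = length ps")
      case True
      then have "ps ! i = last ps" using assms by (simp add: last_conv_nth flip: True)
      moreover have "i < length ps" using True by simp
      ultimately have "e = {x, last ps}" using i(2) True by (simp add: nth_append insert_commute)
      then show ?thesis by simp
    next
      case False
      then show ?thesis using i by (auto simp: path_edges_def nth_append)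
    qed
  qed
next
  have "{x, last ps} = {(ps @ [x]) ! (length ps - 1), (ps @ [x]) ! Suc (length ps - 1)}"
    using assms by (auto simp: nth_append last_conv_nth)
  moreover have "Suc (length ps - 1) < length (ps @ [x])" using assms by simp
  ultimately have "{x, last ps} \<in> path_edges (ps @ [x])"
    unfolding path_edges_def by blast
  moreover have "e \<in> path_edges (ps @ [x])" if "e \<in> path_edges ps" for e
  proof -
    obtain i where "Suc i < length ps" "e = {ps ! i, ps ! Suc i}"
      using \<open>e \<in> path_edges ps\<close> by (auto simp: path_edges_def)
    then have "Suc i < length (ps @ [x])" "e = {(ps @ [x]) ! i, (ps @ [x]) ! Suc i}"
      by (auto simp: nth_append)
    then show ?thesis unfolding path_edges_def by blast
  qed
  ultimately show "insert {x, last ps} (path_edges ps) \<subseteq> path_edges (ps @ [x])" by blast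
qed

lemma path_edges_singleton [simp]: "path_edges [x] = {}"
  by (simp add: path_edges_def)

lemma simple_graph_add_leaf:
  assumes "simple_graph V E" "x \<notin> V" "y \<in> V"
  shows "simple_graph (insert x V) (insert {x, y} E)"
  using assms unfolding simple_graph_def by (auto; metis insertCI)

lemma is_path_mono:
  assumes "is_path V E ps" "V \<subseteq> V'" "E \<subseteq> E'"
  shows "is_path V' E' ps"
  using assms unfolding is_path_def adj_def by blast

lemma is_path_snoc:
  assumes "is_path V E ps" "adj E (last ps) x" "x \<in> V" "x \<notin> set ps"
  shows "is_path V E (ps @ [x])"
  unfolding is_path_def
proof (intro conjI allI impI)
  fix i assume i: "Suc i < length (ps @ [x])"
  show "adj E ((ps @ [x]) ! i) ((ps @ [x]) ! Suc i)"
  proof (cases "Suc i = length ps")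
    case True
    then have "ps \<noteq> []" by auto
    then have "ps ! i = last ps" by (simp add: last_conv_nth flip: True)
    then show ?thesis using True assms(2) by (simp add: nth_append flip: True)
  next
    case False
    then show ?thesis using i assms(1) by (simp add: is_path_def nth_append)
  qed
qed (use assms in \<open>auto simp: is_path_def\<close>)

lemma is_path_Cons:
  assumes "is_path V E ps" "adj E x (hd ps)" "x \<in> V" "x \<notin> set ps"
  shows "is_path V E (x # ps)"
  unfolding is_path_def
proof (intro conjI allI impI)
  fix i assume i: "Suc i < length (x # ps)"
  show "adj E ((x # ps) ! i) ((x # ps) ! Suc i)"
    using i assms by (cases i) (auto simp: is_path_def hd_conv_nth)
qed (use assms in \<open>auto simp: is_path_def\<close>)

lemma is_path_singleton [simp]: "is_path V E [x] \<longleftrightarrow> x \<in> V"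
  by (simp add: is_path_def)

lemma connected_add_leaf:
  assumes con: "connected_graph V E" and x: "x \<notin> V" and y: "y \<in> V"
  shows "connected_graph (insert x V) (insert {x, y} E)"
  unfolding connected_graph_def
proof (intro ballI)
  fix u v assume u: "u \<in> insert x V" and v: "v \<in> insert x V"
  have path: "\<exists>ps. is_path (insert x V) (insert {x, y} E) ps \<and> set ps \<subseteq> V \<and> hd ps = s \<and> last ps = t"
    if st: "s \<in> V" "t \<in> V" for s t
  proof -
    obtain ps where ps: "is_path V E ps" "hd ps = s" "last ps = t"
      using con st unfolding connected_graph_def by blast
    then have "set ps \<subseteq> V" by (simp add: is_path_def)
    moreover have "is_path (insert x V) (insert {x, y} E) ps"
      using ps(1) by (rule is_path_mono) auto
    ultimately show ?thesis using ps by blast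
  qed
  have xy: "adj (insert {x, y} E) x y" "adj (insert {x, y} E) y x"
    using x y by (auto simp: adj_def insert_commute)
  consider "u = x" "v = x" | "u = x" "v \<in> V" | "u \<in> V" "v = x" | "u \<in> V" "v \<in> V"
    using u v by blast
  then show "\<exists>ps. is_path (insert x V) (insert {x, y} E) ps \<and> hd ps = u \<and> last ps = v"
  proof cases
    case 1
    then show ?thesis by (intro exI[of _ "[x]"]) simp
  next
    case 2
    obtain ps where ps: "is_path (insert x V) (insert {x, y} E) ps" "set ps \<subseteq> V" "hd ps = y" "last ps = v"
      using path y 2 by blast
    then have "is_path (insert x V) (insert {x, y} E) (x # ps)"
      using x xy by (intro is_path_Cons) auto
    moreover have "ps \<noteq> []" using ps(1) by (simp add: is_path_def)
    ultimately show ?thesis using ps 2 by (intro exI[of _ "x # ps"]) simp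
  next
    case 3
    obtain ps where ps: "is_path (insert x V) (insert {x, y} E) ps" "set ps \<subseteq> V" "hd ps = u" "last ps = y"
      using path y 3 by blast
    then have "is_path (insert x V) (insert {x, y} E) (ps @ [x])"
      using x xy by (intro is_path_snoc) auto
    moreover have "ps \<noteq> []" using ps(1) by (simp add: is_path_def)
    ultimately show ?thesis using ps 3 by (intro exI[of _ "ps @ [x]"]) simp
  next
    case 4
    then show ?thesis using path by blast
  qed
qed

text \<open>This supplies an edge leaving the part of a tree that has been grown so far.\<close>

lemma path_crossing:
  assumes "ps \<noteq> []" "hd ps \<in> A" "last ps \<notin> A"
  shows "\<exists>i. Suc i < length ps \<and> ps ! i \<in> A \<and> ps ! Suc i \<notin> A"
  using assms
proof (induction ps)
  case (Cons z ps)
  then have ps: "ps \<noteq> []" by (cases ps) auto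
  show ?case
  proof (cases "hd ps \<in> A")
    case True
    then obtain i where "Suc i < length ps" "ps ! i \<in> A" "ps ! Suc i \<notin> A"
      using Cons ps by auto
    then show ?thesis by (intro exI[of _ "Suc i"]) simp
  next
    case False
    then show ?thesis using Cons.prems ps by (intro exI[of _ 0]) (simp add: hd_conv_nth)
  qed
qed simp

text \<open>The new leaf \<open>x\<close> has the ancestors of its parent \<open>y\<close> and
  itself in addition; with any other vertex it shares exactly what \<open>y\<close> shares.\<close>

definition attach :: "('a \<Rightarrow> 'a \<Rightarrow> nat) \<Rightarrow> 'a \<Rightarrow> 'a \<Rightarrow> 'a \<Rightarrow> 'a \<Rightarrow> nat" where
  "attach a x y u v = (if u = x then if v = x then Suc (a y y) else a y v
     else if v = x then a u y else a u v)"

text \<open>Trees grown from a path by adding leaves: \<open>b x\<close> is the index of the path vertex at which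
  the branch of \<open>x\<close> is attached, and \<open>a x y\<close> counts the common ancestors of \<open>x\<close> and \<open>y\<close> off the
  path (a vertex being an ancestor of itself), so that \<open>a x x\<close> is the distance of \<open>x\<close> to the path.\<close>

inductive grown :: "'a list \<Rightarrow> 'a set \<Rightarrow> 'a set set \<Rightarrow> ('a \<Rightarrow> nat) \<Rightarrow> ('a \<Rightarrow> 'a \<Rightarrow> nat) \<Rightarrow> bool"
  for ps where
  path: "(\<And>i. i < length ps \<Longrightarrow> b (ps ! i) = i) \<Longrightarrow> grown ps (set ps) (path_edges ps) b (\<lambda>_ _. 0)"
| leaf: "grown ps V E b a \<Longrightarrow> x \<notin> V \<Longrightarrow> y \<in> V \<Longrightarrow>
    grown ps (insert x V) (insert {x, y} E) (b(x := b y)) (attach a x y)"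

lemma distinct_index:
  assumes "distinct ps"
  shows "\<exists>b. \<forall>i<length ps. b (ps ! i) = i"
proof (intro exI allI impI)
  fix i assume "i < length ps"
  then show "(THE j. j < length ps \<and> ps ! j = ps ! i) = i"
    using assms by (auto simp: nth_eq_iff_index_eq intro!: the_equality)
qed

lemma grown_connected:
  assumes "grown ps V E b a" "ps \<noteq> []" "distinct ps"
  shows "connected_graph V E"
  using assms
proof (induction rule: grown.induct)
  case (path b)
  then show ?case
  proof (induction ps rule: rev_induct)
    case (snoc x ps)
    show ?case
    proof (cases "ps = []")
      case True
      then show ?thesis by (auto simp: connected_graph_def intro!: exI[of _ "[x]"])
    next
      case False
      have "i < length ps \<Longrightarrow> b (ps ! i) = i" for i
        using snoc.prems(1)[of i] by (simp add: nth_append)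
      then have "connected_graph (insert x (set ps)) (insert {x, last ps} (path_edges ps))"
        using snoc False by (intro connected_add_leaf) auto
      then show ?thesis using False by (simp add: path_edges_snoc)
    qed
  qed simp
qed (simp add: connected_add_leaf)

lemma path_edges_subset:
  assumes "is_path V E ps"
  shows "path_edges ps \<subseteq> E"
  using assms by (auto simp: path_edges_def is_path_def adj_def)

text \<open>By connectivity some edge leaves any proper vertex subset containing the path, so a
  grown subtree can be enlarged until it contains all vertices. Acyclicity then leaves no room for
  further edges.\<close>

lemma tree_grown:
  assumes tree: "tree V E" and ps: "is_path V E ps"
  obtains b a where "grown ps V E b a"
proof -
  have fin: "finite V" and sg: "simple_graph V E" and con: "connected_graph V E"
    and acyc: "acyclic_graph V E"
    using tree by (auto simp: tree_def simple_graph_def)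
  have ne: "ps \<noteq> []" and dist: "distinct ps" and sub: "set ps \<subseteq> V"
    using ps by (auto simp: is_path_def)
  have "\<exists>V' E' b a. grown ps V' E' b a \<and> set ps \<subseteq> V' \<and> V' \<subseteq> V \<and> E' \<subseteq> E \<and> card V' = n"
    if "length ps \<le> n" "n \<le> card V" for n
    using that
  proof (induction n rule: dec_induct)
    case base
    obtain b where "\<forall>i<length ps. b (ps ! i) = i" using distinct_index[OF dist] ..
    then have "grown ps (set ps) (path_edges ps) b (\<lambda>_ _. 0)" by (simp add: grown.path)
    moreover have "card (set ps) = length ps" using dist by (rule distinct_card)
    ultimately show ?case using sub path_edges_subset[OF ps] by blast
  next
    case (step n)
    then obtain V' E' b a where g: "grown ps V' E' b a" "set ps \<subseteq> V'" "V' \<subseteq> V" "E' \<subseteq> E" "card V' = n"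
      by auto
    then obtain z where z: "z \<in> V" "z \<notin> V'" using step.prems by (metis Suc_n_not_le_n subsetI subset_antisym)
    have hd: "hd ps \<in> V'" using ne g(2) by auto
    then obtain qs where qs: "is_path V E qs" "hd qs = hd ps" "last qs = z"
      using con z g(3) unfolding connected_graph_def by blast
    obtain i where i: "Suc i < length qs" "qs ! i \<in> V'" "qs ! Suc i \<notin> V'"
      using path_crossing[of qs V'] qs hd z by (auto simp: is_path_def)
    then have "adj E (qs ! i) (qs ! Suc i)" and V: "qs ! Suc i \<in> V"
      using qs(1) by (auto simp: is_path_def)
    then have e: "{qs ! Suc i, qs ! i} \<in> E" by (simp add: adj_def insert_commute)
    have "grown ps (insert (qs ! Suc i) V') (insert {qs ! Suc i, qs ! i} E')
        (b(qs ! Suc i := b (qs ! i))) (attach a (qs ! Suc i) (qs ! i))"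
      using g(1) i(3,2) by (rule grown.leaf)
    moreover have "card (insert (qs ! Suc i) V') = Suc n"
      using g i fin by (simp add: finite_subset)
    ultimately show ?case using g e V by (meson insert_subset subset_insertI2)
  qed
  moreover have "length ps \<le> card V"
    using dist sub fin card_mono distinct_card by metis
  ultimately obtain V' E' b a
    where g: "grown ps V' E' b a" "V' \<subseteq> V" "E' \<subseteq> E" "card V' = card V" by blast
  then have V': "V' = V" using fin by (simp add: card_subset_eq)
  \<comment> \<open>The ends of an edge outside \<open>E'\<close> are joined by a path inside
    \<open>E'\<close>; this path has at least three vertices, and the edge closes it to a
    cycle.\<close>
  have "E \<subseteq> E'"
  proof
    fix e assume e: "e \<in> E"
    then obtain u v where uv: "e = {u, v}" "u \<noteq> v" "u \<in> V" "v \<in> V"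
      using sg unfolding simple_graph_def by blast
    obtain qs where qs: "is_path V E' qs" "hd qs = u" "last qs = v"
      using grown_connected[OF g(1) ne dist] uv V' unfolding connected_graph_def by blast
    show "e \<in> E'"
    proof (rule ccontr)
      assume not: "e \<notin> E'"
      have len: "length qs \<noteq> 0" "length qs \<noteq> 1" using qs uv(2)
        by (auto simp: is_path_def length_Suc_conv)
      have "length qs \<noteq> 2"
      proof
        assume "length qs = 2"
        then have "qs = [u, v]" using qs by (auto simp: length_Suc_conv numeral_2_eq_2)
        then have "adj E' u v" using qs(1) by (auto simp: is_path_def)
        then show False using not uv by (simp add: adj_def)
      qed
      with len have "length qs \<ge> 3" by linarith
      moreover have "is_path V E qs" using is_path_mono[OF qs(1) subset_refl g(3)] .
      moreover have "adj E (last qs) (hd qs)"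
        using e uv qs by (simp add: adj_def insert_commute)
      ultimately show False using acyc unfolding acyclic_graph_def by blast
    qed
  qed
  then have "E' = E" using g(3) by blast
  then show thesis using that g(1) V' by simp
qed

section \<open>Degrees and path metrics of trees under attaching leaves\<close>

lemma degree_add_leaf:
  assumes fin: "finite V" and sg: "simple_graph V E" and x: "x \<notin> V" and y: "y \<in> V"
  shows "degree (insert x V) (insert {x, y} E) x = 1"
    and "degree (insert x V) (insert {x, y} E) y = degree V E y + 1"
    and "v \<in> V \<Longrightarrow> v \<noteq> y \<Longrightarrow> degree (insert x V) (insert {x, y} E) v = degree V E v"
proof -
  have xy: "x \<noteq> y" using x y by auto
  have noE: "\<not> adj E x v" "\<not> adj E v x" for v
    using sg x unfolding adj_def simple_graph_def by (auto simp: doubleton_eq_iff)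
  have adj: "adj (insert {x, y} E) u v \<longleftrightarrow> adj E u v \<or> u = x \<and> v = y \<or> u = y \<and> v = x" for u v
    using xy by (auto simp: adj_def doubleton_eq_iff)
  have "{v \<in> insert x V. adj (insert {x, y} E) x v} = {y}"
    using y xy by (auto simp: adj noE)
  then show "degree (insert x V) (insert {x, y} E) x = 1" by (simp add: degree_def)
  have "{v \<in> insert x V. adj (insert {x, y} E) y v} = insert x {v \<in> V. adj E y v}"
    using y xy by (auto simp: adj noE)
  then show "degree (insert x V) (insert {x, y} E) y = degree V E y + 1"
    using fin x by (simp add: degree_def)
  assume v: "v \<in> V" "v \<noteq> y"
  then have "v \<noteq> x" using x by auto
  then have "{u \<in> insert x V. adj (insert {x, y} E) v u} = {u \<in> V. adj E v u}"
    using v by (auto simp: adj noE)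
  then show "degree (insert x V) (insert {x, y} E) v = degree V E v" by (simp add: degree_def)
qed

text \<open>In a tree, exactly one neighbour of \<open>x \<noteq> k\<close> is closer to
  \<open>k\<close> by one and all others are farther by one; so this is the Laplacian of the
  distance to \<open>k\<close>, and the source in \<open>resistance\<close>.\<close>

abbreviation curv :: "'a set \<Rightarrow> 'a set set \<Rightarrow> 'a \<Rightarrow> real" where
  "curv V E x \<equiv> 2 - real (degree V E x)"

lemma sum_curv_add_leaf:
  assumes "finite V" "simple_graph V E" "x \<notin> V" "y \<in> V"
  shows "(\<Sum>v\<in>insert x V. curv (insert x V) (insert {x, y} E) v * g v)
    = (\<Sum>v\<in>V. curv V E v * g v) - g y + g x"
proof -
  note deg = degree_add_leaf[OF assms]
  have "(\<Sum>v\<in>V. curv (insert x V) (insert {x, y} E) v * g v)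
      = (\<Sum>v\<in>V. curv V E v * g v - (if v = y then g y else 0))"
    by (intro sum.cong refl) (auto simp: deg algebra_simps)
  then show ?thesis
    using assms deg(1) by (simp add: sum_subtractf)
qed

text \<open>The effective resistance of a tree is its path metric.  The last condition is Foster's theorem
  in the form \<open>\<Sum>k. deg k * R z k = 2 * (\<Sum>k. R z k) - (card V - 1)\<close>.\<close>

definition tree_metric :: "'a set \<Rightarrow> 'a set set \<Rightarrow> ('a \<Rightarrow> 'a \<Rightarrow> real) \<Rightarrow> bool" where
  "tree_metric V E R \<longleftrightarrow> simple_graph V E \<and> resistance V E (curv V E) R \<and>
     (\<Sum>k\<in>V. curv V E k) = 2 \<and> (\<forall>z\<in>V. (\<Sum>k\<in>V. curv V E k * R z k) = real (card V) - 1)"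

lemma tree_metric_singleton:
  assumes "R x x = 0"
  shows "tree_metric {x} {} R"
  using assms by (simp add: tree_metric_def resistance_def simple_graph_def lap_def degree_def adj_def)

text \<open>In Foster's identity both sides grow by one. For an old \<open>z\<close> this is the
  extra step from \<open>y\<close> to \<open>x\<close>; for \<open>z = x\<close> all distances grow
  by one against total weight two, and the correction at \<open>y\<close> takes one back.\<close>

lemma tree_metric_add_leaf:
  assumes R: "tree_metric V E R" and x: "x \<notin> V" and y: "y \<in> V"
    and on: "\<And>u v. u \<in> V \<Longrightarrow> v \<in> V \<Longrightarrow> R' u v = R u v"
    and l: "\<And>v. v \<in> V \<Longrightarrow> R' x v = R y v + 1" and l': "\<And>v. v \<in> V \<Longrightarrow> R' v x = R y v + 1"
    and d: "R' x x = 0"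
  shows "tree_metric (insert x V) (insert {x, y} E) R'"
proof -
  have sg: "simple_graph V E" and res: "resistance V E (curv V E) R"
    and total: "(\<Sum>k\<in>V. curv V E k) = 2"
    and foster: "\<And>z. z \<in> V \<Longrightarrow> (\<Sum>k\<in>V. curv V E k * R z k) = real (card V) - 1"
    using R by (auto simp: tree_metric_def)
  have fin: "finite V" using sg by (simp add: simple_graph_def)
  have sym: "R u v = R v u" if "u \<in> V" "v \<in> V" for u v
    using res that by (simp add: resistance_def)
  have Ryy: "R y y = 0" using res y by (simp add: resistance_def)
  note deg = degree_add_leaf[OF fin sg x y]
  have xy: "x \<noteq> y" using x y by auto
  have "resistance (insert x V) (insert {x, y} E) ((curv V E)(y := curv V E y - 1, x := 1)) R'"
    using res fin sg x y on l l' d by (rule resistance_add_leaf)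
  then have "resistance (insert x V) (insert {x, y} E) (curv (insert x V) (insert {x, y} E)) R'"
    by (rule resistance_cong) (use deg xy in auto)
  moreover have "(\<Sum>k\<in>insert x V. curv (insert x V) (insert {x, y} E) k * R' z k)
      = real (card (insert x V)) - 1" if z: "z \<in> insert x V" for z
  proof (cases "z = x")
    case True
    have "(\<Sum>k\<in>V. curv V E k * R' z k) = (\<Sum>k\<in>V. curv V E k * R y k + curv V E k)"
      using True by (intro sum.cong refl) (simp add: l distrib_left)
    also have "\<dots> = real (card V) + 1"
      using foster[OF y] total by (simp only: sum.distrib)
    finally show ?thesis
      unfolding sum_curv_add_leaf[OF fin sg x y] using True d l[OF y] Ryy fin x by simp
  next
    case False
    then have z: "z \<in> V" using z by simp
    have "(\<Sum>k\<in>V. curv V E k * R' z k) = real (card V) - 1"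
      using foster[OF z] z by (simp add: on)
    then show ?thesis
      unfolding sum_curv_add_leaf[OF fin sg x y]
      using z y l'[OF z] on[OF z y] sym[OF z y] fin x by simp
  qed
  moreover have "(\<Sum>k\<in>insert x V. curv (insert x V) (insert {x, y} E) k) = 2"
    using sum_curv_add_leaf[OF fin sg x y, of "\<lambda>_. 1"] total by simp
  ultimately show ?thesis
    using simple_graph_add_leaf[OF sg x y] by (simp add: tree_metric_def)
qed

text \<open>Down to the path, along it and up again; the shared part of the two climbs is taken off
  twice.\<close>

definition tdist :: "('a \<Rightarrow> nat) \<Rightarrow> ('a \<Rightarrow> 'a \<Rightarrow> nat) \<Rightarrow> 'a \<Rightarrow> 'a \<Rightarrow> real" where
  "tdist b a x y = real (a x x) + real (a y y) + \<bar>real (b x) - real (b y)\<bar> - 2 * real (a x y)"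

text \<open>On a path the weight \<open>curv\<close> is one at each end and zero inside. On a single
  vertex it is two, and both terms on the right then refer to that vertex.\<close>

lemma tree_metric_path:
  assumes "ps \<noteq> []" "distinct ps" "\<And>i. i < length ps \<Longrightarrow> b (ps ! i) = i"
  shows "tree_metric (set ps) (path_edges ps) (tdist b (\<lambda>_ _. 0)) \<and>
    (\<forall>g :: nat \<Rightarrow> real. (\<Sum>x\<in>set ps. curv (set ps) (path_edges ps) x * g (b x))
      = g 0 + g (length ps - 1))"
  using assms
proof (induction ps rule: rev_induct)
  case (snoc x ps)
  show ?case
  proof (cases "ps = []")
    case True
    then show ?thesis
    proof -
      have "tdist b (\<lambda>_ _. 0) x x = 0" by (simp add: tdist_def)
      then show ?thesis
        using True snoc.prems(3)[of 0] tree_metric_singleton[of "tdist b (\<lambda>_ _. 0)" x]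
        by (simp add: degree_def adj_def)
    qed
  next
    case False
    have b: "i < length ps \<Longrightarrow> b (ps ! i) = i" for i
      using snoc.prems(3)[of i] by (simp add: nth_append)
    have bx: "b x = length ps" using snoc.prems(3)[of "length ps"] by simp
    have bl: "b (last ps) = length ps - 1" using b[of "length ps - 1"] False by (simp add: last_conv_nth)
    have bv: "b v < length ps" if "v \<in> set ps" for v
      using that b by (metis in_set_conv_nth)
    have x: "x \<notin> set ps" and y: "last ps \<in> set ps" using snoc.prems False by auto
    note IH = snoc.IH[OF False _ b]
    have tm: "tree_metric (set ps) (path_edges ps) (tdist b (\<lambda>_ _. 0))"
      using IH snoc.prems by simp
    have sum: "(\<Sum>x\<in>set ps. curv (set ps) (path_edges ps) x * g (b x)) = g 0 + g (length ps - 1)"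
      for g using IH snoc.prems by simp
    have sg: "simple_graph (set ps) (path_edges ps)" using tm by (simp add: tree_metric_def)
    have E: "path_edges (ps @ [x]) = insert {x, last ps} (path_edges ps)"
      using False by (rule path_edges_snoc)
    have V: "set (ps @ [x]) = insert x (set ps)" by simp
    have "tree_metric (insert x (set ps)) (insert {x, last ps} (path_edges ps)) (tdist b (\<lambda>_ _. 0))"
    proof (rule tree_metric_add_leaf[OF tm x y])
      fix v assume "v \<in> set ps"
      then have "b v < length ps" by (rule bv)
      then show "tdist b (\<lambda>_ _. 0) x v = tdist b (\<lambda>_ _. 0) (last ps) v + 1"
        and "tdist b (\<lambda>_ _. 0) v x = tdist b (\<lambda>_ _. 0) (last ps) v + 1"
        unfolding tdist_def bx bl by auto
    qed (simp_all add: tdist_def)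
    moreover have "(\<Sum>v\<in>insert x (set ps).
        curv (insert x (set ps)) (insert {x, last ps} (path_edges ps)) v * g (b v)) = g 0 + g (length ps)"
      for g
      using sum_curv_add_leaf[OF _ sg x y, of "\<lambda>v. g (b v)"] sum[of g] bx bl by simp
    ultimately show ?thesis unfolding E V by simp
  qed
qed simp

context
  fixes ps :: "'a list"
  assumes ne: "ps \<noteq> []" and distinct: "distinct ps"
begin

lemma grown_sets:
  assumes "grown ps V E b a"
  shows "set ps \<subseteq> V" and "finite V" and "length ps \<le> card V"
    and "i < length ps \<Longrightarrow> b (ps ! i) = i" and "x \<in> V \<Longrightarrow> b x < length ps"
proof -
  have "set ps \<subseteq> V \<and> finite V \<and> (\<forall>i<length ps. b (ps ! i) = i) \<and> (\<forall>x\<in>V. b x < length ps)"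
    using assms
  proof (induction rule: grown.induct)
    case (path b)
    then show ?case by (auto simp: in_set_conv_nth)
  next
    case (leaf V E b a x y)
    have "ps ! i \<noteq> x" if "i < length ps" for i
      using leaf that nth_mem by blast
    then show ?case using leaf by auto
  qed
  then show "set ps \<subseteq> V" "finite V" "i < length ps \<Longrightarrow> b (ps ! i) = i" "x \<in> V \<Longrightarrow> b x < length ps"
    by blast+
  then show "length ps \<le> card V" using distinct card_mono distinct_card by metis
qed

text \<open>The third part says that the ancestors of a vertex are distinct vertices off the path,
  so its depth is at most \<open>card V - length ps\<close>.\<close>

lemma grown_ancestors:
  assumes "grown ps V E b a"
  shows "u \<in> V \<Longrightarrow> v \<in> V \<Longrightarrow> a u v = a v u"
    and "u \<in> V \<Longrightarrow> v \<in> V \<Longrightarrow> a u v \<le> a v v"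
    and "u \<in> V \<Longrightarrow> a u u + length ps \<le> card V"
    and "p \<in> set ps \<Longrightarrow> v \<in> V \<Longrightarrow> a v p = 0"
proof -
  have inv: "(\<forall>u\<in>V. \<forall>v\<in>V. a u v = a v u \<and> a u v \<le> a v v) \<and>
      (\<forall>u\<in>V. a u u + length ps \<le> card V) \<and> (\<forall>v\<in>V. \<forall>p\<in>set ps. a v p = 0)"
    using assms
  proof (induction rule: grown.induct)
    case (path b)
    then show ?case using distinct by (simp add: distinct_card)
  next
    case (leaf V E b a x y)
    have "finite V" "set ps \<subseteq> V" using grown_sets[OF leaf(1)] by blast+
    then have card: "card (insert x V) = Suc (card V)" and xps: "x \<notin> set ps"
      using leaf(2) by auto
    have depth: "a u u + length ps \<le> card V" if "u \<in> V" for u using leaf(4) that by blast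
    have A: "attach a x y u v = attach a x y v u \<and> attach a x y u v \<le> attach a x y v v"
      if "u \<in> insert x V" "v \<in> insert x V" for u v
    proof -
      have old: "a u v = a v u" "a u v \<le> a v v" if "u \<in> V" "v \<in> V" for u v
        using leaf(4) that by blast+
      show ?thesis
        using that old[of u v] old[of u y] old(2)[of y v] old(1)[of y v] leaf(3)
        unfolding attach_def by (cases "u = x"; cases "v = x") (auto intro: le_SucI)
    qed
    have B: "attach a x y u u + length ps \<le> card (insert x V)" if "u \<in> insert x V" for u
      using that depth[of u] depth[OF leaf(3)] unfolding card attach_def
      by (cases "u = x") (simp_all add: le_SucI)
    have C: "attach a x y v p = 0" if "v \<in> insert x V" "p \<in> set ps" for v p
      using that leaf xps by (auto simp: attach_def)
    show ?case by (intro conjI ballI A[THEN conjunct1] A[THEN conjunct2] B C)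
  qed
  show "a u v = a v u" if "u \<in> V" "v \<in> V"
    using inv[THEN conjunct1, rule_format, OF that, THEN conjunct1] .
  show "a u v \<le> a v v" if "u \<in> V" "v \<in> V"
    using inv[THEN conjunct1, rule_format, OF that, THEN conjunct2] .
  show "a u u + length ps \<le> card V" if "u \<in> V"
    using inv[THEN conjunct2, THEN conjunct1, rule_format, OF that] .
  show "a v p = 0" if "p \<in> set ps" "v \<in> V"
    using inv[THEN conjunct2, THEN conjunct2, rule_format, OF that(2,1)] .
qed

text \<open>A leaf inherits the branch index of its parent, so the weight it takes from the parent
  in the second sum comes back under the same index.\<close>

lemma grown_tree_metric:
  assumes "grown ps V E b a"
  shows "tree_metric V E (tdist b a)"
    and "(\<Sum>x\<in>V. curv V E x * g (b x)) = g 0 + g (length ps - 1)"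
proof -
  have "tree_metric V E (tdist b a) \<and>
      (\<forall>g :: nat \<Rightarrow> real. (\<Sum>x\<in>V. curv V E x * g (b x)) = g 0 + g (length ps - 1))"
    using assms
  proof (induction rule: grown.induct)
    case (path b)
    then show ?case using tree_metric_path[OF ne distinct] by blast
  next
    case (leaf V E b a x y)
    then have tm: "tree_metric V E (tdist b a)"
      and sum: "(\<Sum>x\<in>V. curv V E x * g (b x)) = g 0 + g (length ps - 1)" for g by blast+
    have xV: "v \<noteq> x" if "v \<in> V" for v using leaf that by blast
    note sym = grown_ancestors(1)[OF leaf(1)]
    have "tree_metric (insert x V) (insert {x, y} E) (tdist (b(x := b y)) (attach a x y))"
    proof (rule tree_metric_add_leaf[OF tm leaf(2,3)])
      fix v assume v: "v \<in> V"
      show "tdist (b(x := b y)) (attach a x y) x v = tdist b a y v + 1"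
        using xV[OF v] by (simp add: tdist_def attach_def)
      show "tdist (b(x := b y)) (attach a x y) v x = tdist b a y v + 1"
        using xV[OF v] sym[OF v leaf(3)] by (simp add: tdist_def attach_def)
    next
      fix u v assume "u \<in> V" "v \<in> V"
      then show "tdist (b(x := b y)) (attach a x y) u v = tdist b a u v"
        using xV by (simp add: tdist_def attach_def)
    qed (simp add: tdist_def)
    moreover have "(\<Sum>v\<in>insert x V. curv (insert x V) (insert {x, y} E) v * g ((b(x := b y)) v))
        = g 0 + g (length ps - 1)" for g
    proof -
      have "finite V" "simple_graph V E" using tm by (auto simp: tree_metric_def simple_graph_def)
      moreover have "(\<Sum>v\<in>V. curv V E v * g ((b(x := b y)) v)) = (\<Sum>v\<in>V. curv V E v * g (b v))"
        using xV by (intro sum.cong refl) simp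
      ultimately show ?thesis
        using sum_curv_add_leaf[OF _ _ leaf(2,3), of E "\<lambda>v. g ((b(x := b y)) v)"]
          sum[of g] xV[OF leaf(3)] by simp
    qed
    ultimately show ?case by blast
  qed
  then show "tree_metric V E (tdist b a)"
    and "(\<Sum>x\<in>V. curv V E x * g (b x)) = g 0 + g (length ps - 1)" by blast+
qed

end

section \<open>Closing the path to a cycle\<close>

lemma degree_add_edge:
  assumes fin: "finite V" and pq: "p \<in> V" "q \<in> V" "p \<noteq> q" and new: "\<not> adj E p q"
  shows "degree V (insert {p, q} E) x = degree V E x + of_bool (x = p) + of_bool (x = q)"
proof -
  have adj: "adj (insert {p, q} E) x y \<longleftrightarrow> adj E x y \<or> x = p \<and> y = q \<or> x = q \<and> y = p" for x y
    using pq(3) by (auto simp: adj_def doubleton_eq_iff)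
  have new': "\<not> adj E q p" using new adj_commute by metis
  consider "x = p" | "x = q" | "x \<noteq> p" "x \<noteq> q" by blast
  then show ?thesis
  proof cases
    case 1
    then have "{y \<in> V. adj (insert {p, q} E) x y} = insert q {y \<in> V. adj E x y}"
      using pq by (auto simp: adj)
    then show ?thesis using 1 new pq(3) fin by (simp add: degree_def)
  next
    case 2
    then have "{y \<in> V. adj (insert {p, q} E) x y} = insert p {y \<in> V. adj E x y}"
      using pq by (auto simp: adj)
    then show ?thesis using 2 new' pq(3) fin by (simp add: degree_def)
  next
    case 3
    then show ?thesis by (simp add: degree_def adj)
  qed
qed

definition wt :: "nat \<Rightarrow> nat \<Rightarrow> nat \<Rightarrow> nat \<Rightarrow> real" where
  "wt n c i j = \<bar>real i - real j\<bar> + (real n - 1) / real c * (real i - real j)\<^sup>2"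

text \<open>The diagonal terms \<open>a x x\<close> are removed from the sum over all pairs.\<close>

definition excess :: "'a set \<Rightarrow> nat \<Rightarrow> nat \<Rightarrow> ('a \<Rightarrow> nat) \<Rightarrow> ('a \<Rightarrow> 'a \<Rightarrow> nat) \<Rightarrow> real" where
  "excess V n c b a = 2 * (\<Sum>x\<in>V. \<Sum>y\<in>V. real (a x y)) - 2 * (\<Sum>x\<in>V. real (a x x))
    - (\<Sum>x\<in>V. \<Sum>y\<in>V. wt n c (b x) (b y))"

section \<open>Kemeny's constants of the tree and of the unicyclic graph\<close>

context
  fixes ps :: "'a list" and V E b a n c
  assumes ne: "ps \<noteq> []" and distinct: "distinct ps"
    and grown: "grown ps V E b a"
    and n: "n = card V" and c: "c = length ps" and c2: "2 \<le> c"
begin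

private abbreviation "d \<equiv> tdist b a"
private abbreviation "S \<equiv> \<Sum>x\<in>V. \<Sum>y\<in>V. d x y"

private lemma fin: "finite V"
  using grown_sets[OF ne distinct grown] by blast

private lemma cn: "c \<le> n"
  using grown_sets(3)[OF ne distinct grown] n c by simp

private lemma dist_sym: "x \<in> V \<Longrightarrow> y \<in> V \<Longrightarrow> d x y = d y x"
  using grown_tree_metric(1)[OF ne distinct grown] by (simp add: tree_metric_def resistance_def)

private lemma sum_degree_branch:
  "(\<Sum>x\<in>V. real (degree V E x) * g (b x)) = 2 * (\<Sum>x\<in>V. g (b x)) - g 0 - g (c - 1)"
  using grown_tree_metric(2)[OF ne distinct grown, of g]
  by (simp add: left_diff_distrib sum_subtractf sum_distrib_left c)

private lemma sum_degree: "(\<Sum>x\<in>V. real (degree V E x)) = 2 * (real n - 1)"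
  using sum_degree_branch[of "\<lambda>_. 1"] by (simp add: n)

private lemma sum_degree_dist:
  assumes "x \<in> V"
  shows "(\<Sum>y\<in>V. real (degree V E y) * d x y) = 2 * (\<Sum>y\<in>V. d x y) - (real n - 1)"
proof -
  have "(\<Sum>k\<in>V. curv V E k * d x k) = real n - 1"
    using grown_tree_metric(1)[OF ne distinct grown] assms n by (simp add: tree_metric_def)
  then show ?thesis by (simp add: left_diff_distrib sum_subtractf sum_distrib_left)
qed

text \<open>Foster's identity is used once in each variable.\<close>

private lemma sum_degree_degree_dist:
  "(\<Sum>x\<in>V. \<Sum>y\<in>V. real (degree V E x) * real (degree V E y) * d x y)
    = 4 * S - 2 * real n * (real n - 1) - 2 * (real n - 1)\<^sup>2"
proof -
  have "(\<Sum>x\<in>V. \<Sum>y\<in>V. real (degree V E x) * real (degree V E y) * d x y)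
      = (\<Sum>x\<in>V. real (degree V E x) * (2 * (\<Sum>y\<in>V. d x y) - (real n - 1)))"
    by (intro sum.cong refl) (simp add: mult.assoc flip: sum_degree_dist sum_distrib_left)
  also have "\<dots> = 2 * (\<Sum>x\<in>V. \<Sum>y\<in>V. real (degree V E x) * d x y)
      - (\<Sum>x\<in>V. real (degree V E x)) * (real n - 1)"
    by (simp add: right_diff_distrib sum_subtractf sum_distrib_left sum_distrib_right
        mult.left_commute)
  also have "(\<Sum>x\<in>V. \<Sum>y\<in>V. real (degree V E x) * d x y)
      = (\<Sum>y\<in>V. \<Sum>x\<in>V. real (degree V E x) * d x y)"
    by (rule sum.swap)
  also have "\<dots> = (\<Sum>y\<in>V. 2 * (\<Sum>x\<in>V. d y x) - (real n - 1))"
  proof (intro sum.cong refl)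
    fix y assume y: "y \<in> V"
    have "(\<Sum>x\<in>V. real (degree V E x) * d x y) = (\<Sum>x\<in>V. real (degree V E x) * d y x)"
      using dist_sym[OF _ y] by (intro sum.cong refl) simp
    then show "(\<Sum>x\<in>V. real (degree V E x) * d x y) = 2 * (\<Sum>x\<in>V. d y x) - (real n - 1)"
      using sum_degree_dist[OF y] by simp
  qed
  also have "\<dots> = 2 * S - real n * (real n - 1)"
    by (simp add: sum_subtractf sum_distrib_left n)
  finally show ?thesis
    unfolding sum_degree by (simp add: power2_eq_square algebra_simps)
qed

private lemma resistance_dist: "resistance V E (curv V E) d"
  using grown_tree_metric(1)[OF ne distinct grown] by (simp add: tree_metric_def)

private lemma kemeny_tree:
  "kemeny V E = (4 * S - 2 * real n * (real n - 1) - 2 * (real n - 1)\<^sup>2) / (4 * (real n - 1))"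
  unfolding kemeny_eq[OF resistance_dist fin, folded n, OF order.trans[OF c2 cn]]
    sum_degree sum_degree_degree_dist by simp

context
  fixes p q
  assumes p: "p = hd ps" and q: "q = last ps" and new: "\<not> adj E p q"
begin

private lemma ends: "p \<in> V" "q \<in> V" "p \<noteq> q" "b p = 0" "b q = c - 1" "a p p = 0" "a q q = 0"
    "x \<in> V \<Longrightarrow> a x p = 0" "x \<in> V \<Longrightarrow> a x q = 0"
proof -
  have pq: "p \<in> set ps" "q \<in> set ps" using ne p q by auto
  then show V: "p \<in> V" "q \<in> V" using grown_sets(1)[OF ne distinct grown] by auto
  show "a p p = 0" "a q q = 0" "x \<in> V \<Longrightarrow> a x p = 0" "x \<in> V \<Longrightarrow> a x q = 0"
    using pq V grown_ancestors(4)[OF ne distinct grown] by auto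
  show "b p = 0"
    using grown_sets(4)[OF ne distinct grown, of 0] p ne by (simp add: hd_conv_nth)
  moreover show "b q = c - 1"
    using grown_sets(4)[OF ne distinct grown, of "c - 1"] q ne c by (simp add: last_conv_nth)
  ultimately show "p \<noteq> q" using c2 by auto
qed

private lemma dist_ends:
  assumes "x \<in> V"
  shows "d x p = real (a x x) + real (b x)" and "d x q = real (a x x) + (real c - 1 - real (b x))"
proof -
  have "b x < c" using grown_sets(5)[OF ne distinct grown assms] c by simp
  then show "d x p = real (a x x) + real (b x)" "d x q = real (a x x) + (real c - 1 - real (b x))"
    using assms by (simp_all add: tdist_def ends)
qed

text \<open>Here \<open>1 + d p q = c\<close>, so \<open>resistance_add_edge\<close> subtracts the
  squared difference of branch indices over \<open>c\<close>. The depths enter because the degrees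
  of \<open>p\<close> and \<open>q\<close> grow by one, which brings in the distances to both
  ends.\<close>

private lemma kemeny_unicyclic:
  "kemeny V (insert {p, q} E) = (4 * S - 2 * real n * (real n - 1) - 2 * (real n - 1)\<^sup>2
     + 8 * (\<Sum>x\<in>V. real (a x x)) + 4 * real n * (real c - 1) - 4 * (real n - 1) + 2 * (real c - 1)
     - 4 / real c * (\<Sum>x\<in>V. \<Sum>y\<in>V. (real (b x) - real (b y))\<^sup>2)) / (4 * real n)"
proof -
  define D where "D x = real (degree V E x)" for x
  define D' where "D' x = D x + of_bool (x = p) + of_bool (x = q)" for x
  define R where "R x y = d x y - (real (b x) - real (b y))\<^sup>2 / real c" for x y
  define H where "H = (\<Sum>x\<in>V. real (a x x))"
  have deg': "real (degree V (insert {p, q} E) x) = D' x" for x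
    using degree_add_edge[OF fin ends(1-3) new] by (simp add: D'_def D_def)
  have dpq: "d p q = real c - 1" and dqp: "d q p = real c - 1"
    using dist_ends(2)[OF ends(1)] dist_ends(1)[OF ends(2)] ends c2 by simp_all
  have dpp: "d p p = 0" "d q q = 0" by (simp_all add: tdist_def)
  have "\<exists>f. resistance V (insert {p, q} E) f (\<lambda>x y. d x y
      - ((d x p - d x q) - (d y p - d y q))\<^sup>2 / (4 * (1 + d p q)))"
    using resistance_dist fin ends(1-3) new by (rule resistance_add_edge) (use dpq c2 in simp)
  then obtain f where res0: "resistance V (insert {p, q} E) f (\<lambda>x y. d x y
      - ((d x p - d x q) - (d y p - d y q))\<^sup>2 / (4 * (1 + d p q)))" by blast
  have Req: "d x y - ((d x p - d x q) - (d y p - d y q))\<^sup>2 / (4 * (1 + d p q)) = R x y"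
    if "x \<in> V" "y \<in> V" for x y
  proof -
    \<comment> \<open>The depth of a vertex occurs in both of its distances to the ends and cancels;
      the factor two absorbs the four in the denominator.\<close>
    have "(d x p - d x q) - (d y p - d y q) = 2 * (real (b x) - real (b y))"
      using that by (simp add: dist_ends)
    then show ?thesis by (simp only: R_def dpq power_mult_distrib) simp
  qed
  have res: "resistance V (insert {p, q} E) f R"
    using res0 by (rule resistance_cong) (simp_all only: Req)
  have sumD': "(\<Sum>x\<in>V. D' x * g x) = (\<Sum>x\<in>V. D x * g x) + g p + g q" for g :: "'a \<Rightarrow> real"
  proof -
    have "(\<Sum>x\<in>V. D' x * g x) = (\<Sum>x\<in>V. D x * g x + (if x = p then g p else 0) + (if x = q then g q else 0))"
      by (intro sum.cong refl) (simp add: D'_def distrib_right)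
    then show ?thesis using fin ends(1,2) by (simp add: sum.distrib)
  qed
  \<comment> \<open>The degree gained at each end compensates the terms \<open>g 0\<close> and
    \<open>g (c - 1)\<close> missing in the tree.\<close>
  have sumD'_branch: "(\<Sum>x\<in>V. D' x * g (b x)) = 2 * (\<Sum>x\<in>V. g (b x))" for g
    using sumD'[of "\<lambda>x. g (b x)"] sum_degree_branch[of g] by (simp add: D_def ends)
  have vol: "(\<Sum>x\<in>V. D' x) = 2 * real n"
    using sumD'_branch[of "\<lambda>_. 1"] by (simp add: n)
  have "(\<Sum>x\<in>V. \<Sum>y\<in>V. D' x * D' y * (real (b x) - real (b y))\<^sup>2)
      = (\<Sum>x\<in>V. D' x * (2 * (\<Sum>y\<in>V. (real (b x) - real (b y))\<^sup>2)))"
  proof (intro sum.cong refl)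
    fix x
    show "(\<Sum>y\<in>V. D' x * D' y * (real (b x) - real (b y))\<^sup>2)
        = D' x * (2 * (\<Sum>y\<in>V. (real (b x) - real (b y))\<^sup>2))"
      using sumD'_branch[of "\<lambda>i. (real (b x) - real i)\<^sup>2"]
      by (simp only: mult.assoc flip: sum_distrib_left)
  qed
  also have "\<dots> = 4 * (\<Sum>x\<in>V. \<Sum>y\<in>V. (real (b x) - real (b y))\<^sup>2)"
    using sumD'_branch[of "\<lambda>i. 2 * (\<Sum>y\<in>V. (real i - real (b y))\<^sup>2)"]
    by (simp add: sum_distrib_left)
  finally have Q: "(\<Sum>x\<in>V. \<Sum>y\<in>V. D' x * D' y * (real (b x) - real (b y))\<^sup>2)
      = 4 * (\<Sum>x\<in>V. \<Sum>y\<in>V. (real (b x) - real (b y))\<^sup>2)" .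
  have DD: "(\<Sum>x\<in>V. \<Sum>y\<in>V. D x * D y * d x y)
      = 4 * S - 2 * real n * (real n - 1) - 2 * (real n - 1)\<^sup>2"
    unfolding D_def by (rule sum_degree_degree_dist)
  have Dend: "(\<Sum>x\<in>V. D x * d x z) = 2 * (\<Sum>x\<in>V. d x z) - (real n - 1)" if "z \<in> V" for z
  proof -
    have "(\<Sum>x\<in>V. D x * d x z) = (\<Sum>x\<in>V. D x * d z x)" "(\<Sum>x\<in>V. d x z) = (\<Sum>x\<in>V. d z x)"
      using dist_sym[OF _ that] by (auto intro!: sum.cong)
    then show ?thesis using sum_degree_dist[OF that] by (simp add: D_def)
  qed
  have ends_sum: "(\<Sum>x\<in>V. d x p) + (\<Sum>x\<in>V. d x q) = 2 * H + real n * (real c - 1)"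
  proof -
    have "(\<Sum>x\<in>V. d x p) + (\<Sum>x\<in>V. d x q) = (\<Sum>x\<in>V. 2 * real (a x x) + (real c - 1))"
      unfolding sum.distrib[symmetric] by (intro sum.cong refl) (simp add: dist_ends)
    then show ?thesis by (simp add: sum.distrib H_def n sum_distrib_left)
  qed
  have "(\<Sum>x\<in>V. \<Sum>y\<in>V. D' x * D' y * d x y) = (\<Sum>x\<in>V. D' x * ((\<Sum>y\<in>V. D y * d x y) + d x p + d x q))"
    by (intro sum.cong refl) (simp add: mult.assoc sumD' flip: sum_distrib_left)
  also have "\<dots> = (\<Sum>x\<in>V. D x * ((\<Sum>y\<in>V. D y * d x y) + d x p + d x q))
      + ((\<Sum>y\<in>V. D y * d p y) + d p p + d p q) + ((\<Sum>y\<in>V. D y * d q y) + d q p + d q q)"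
    by (simp only: sumD')
  also have "(\<Sum>x\<in>V. D x * ((\<Sum>y\<in>V. D y * d x y) + d x p + d x q))
      = (\<Sum>x\<in>V. \<Sum>y\<in>V. D x * D y * d x y) + (\<Sum>x\<in>V. D x * d x p) + (\<Sum>x\<in>V. D x * d x q)"
    by (simp only: distrib_left sum.distrib) (simp add: mult.assoc flip: sum_distrib_left)
  also have "(\<Sum>y\<in>V. D y * d p y) = (\<Sum>x\<in>V. D x * d x p)"
    using dist_sym[OF ends(1)] by (intro sum.cong refl) simp
  also have "(\<Sum>y\<in>V. D y * d q y) = (\<Sum>x\<in>V. D x * d x q)"
    using dist_sym[OF ends(2)] by (intro sum.cong refl) simp
  finally have D'D': "(\<Sum>x\<in>V. \<Sum>y\<in>V. D' x * D' y * d x y)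
      = 4 * S - 2 * real n * (real n - 1) - 2 * (real n - 1)\<^sup>2
        + 2 * (2 * (2 * H + real n * (real c - 1)) - 2 * (real n - 1)) + 2 * (real c - 1)"
    unfolding DD Dend[OF ends(1)] Dend[OF ends(2)] dpq dqp dpp using ends_sum by (simp add: algebra_simps)
  have "(\<Sum>x\<in>V. \<Sum>y\<in>V. D' x * D' y * R x y) = (\<Sum>x\<in>V. \<Sum>y\<in>V. D' x * D' y * d x y)
      - (\<Sum>x\<in>V. \<Sum>y\<in>V. D' x * D' y * (real (b x) - real (b y))\<^sup>2) / real c"
    unfolding R_def by (simp only: right_diff_distrib sum_subtractf sum_divide_distrib times_divide_eq_right)
  moreover have "2 \<le> card V" using c2 cn n by simp
  ultimately show ?thesis
    unfolding kemeny_eq[OF res fin \<open>2 \<le> card V\<close>] deg' vol D'D' Q H_def[symmetric]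
    by (simp add: algebra_simps)
qed

text \<open>Over the common denominator \<open>S\<close> keeps coefficient \<open>-1\<close>. Its
  part \<open>2 * n * H\<close>, with \<open>H\<close> the sum of depths, meets
  \<open>2 * (n - 1) * H\<close> from the new edge; the remaining \<open>-2 * H\<close> is the
  removal of the diagonal in \<open>excess\<close>.\<close>

lemma kemeny_diff:
  "real n * (real n - 1) * (kemeny V (insert {p, q} E) - kemeny V E) = excess V n c b a
    + (real n - 1) * (4 * real n * (real c - 1) - 4 * (real n - 1) + 2 * (real c - 1)
       - 2 * real n * (real n - 1) - 2 * (real n - 1)\<^sup>2) / 4
    + real n * (2 * real n * (real n - 1) + 2 * (real n - 1)\<^sup>2) / 4"
proof -
  define H A P Q where "H = (\<Sum>x\<in>V. real (a x x))" and "A = (\<Sum>x\<in>V. \<Sum>y\<in>V. real (a x y))"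
    and "P = (\<Sum>x\<in>V. \<Sum>y\<in>V. \<bar>real (b x) - real (b y)\<bar>)"
    and "Q = (\<Sum>x\<in>V. \<Sum>y\<in>V. (real (b x) - real (b y))\<^sup>2)"
  have S: "S = 2 * real n * H + P - 2 * A"
    unfolding tdist_def sum.distrib sum_subtractf H_def A_def P_def
    by (simp add: n sum_distrib_left algebra_simps)
  have exc: "excess V n c b a = 2 * A - 2 * H - P - (real n - 1) / real c * Q"
    unfolding excess_def wt_def sum.distrib H_def A_def P_def Q_def
    by (simp add: sum_distrib_left)
  have "real n > 1" using c2 cn by linarith
  moreover have "real c > 0" using c2 by linarith
  ultimately show ?thesis
    unfolding kemeny_unicyclic kemeny_tree S exc H_def[symmetric] Q_def[symmetric]
    by (simp add: field_simps power2_eq_square)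
qed

end

end

section \<open>Extremal trees\<close>

definition row :: "nat \<Rightarrow> nat \<Rightarrow> nat \<Rightarrow> real" where
  "row n c i = (\<Sum>j<c. wt n c i j)"

text \<open>Induction on \<open>c\<close> starts with all indices \<open>j\<close> below
  \<open>i\<close>, hence the first case.\<close>

lemma sum_abs_diff:
  "(\<Sum>j<c. \<bar>real i - real j\<bar>) = (if c \<le> i then real c * real i - real c * (real c - 1) / 2
    else real i * (real i + 1) / 2 + (real c - 1 - real i) * (real c - real i) / 2)"
proof (induction c)
  case (Suc c)
  consider "Suc c \<le> i" | "c = i" | "i < c" by linarith
  then show ?case
  proof cases
    case 3
    then have "\<bar>real i - real c\<bar> = real c - real i" by simp
    then show ?thesis using Suc 3 by (simp add: field_simps)
  qed (use Suc in \<open>simp_all add: field_simps\<close>)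
qed simp

lemma sum_sq_diff:
  "(\<Sum>j<c. (real i - real j)\<^sup>2)
    = real c * (real i)\<^sup>2 - real i * real c * (real c - 1) + (real c - 1) * real c * (2 * real c - 1) / 6"
  by (induction c) (simp_all add: field_simps power2_eq_square)

text \<open>Both sums depend on \<open>i\<close> only through \<open>i * (c - 1 - i)\<close>, with
  coefficient \<open>-1\<close> from the distances and \<open>-(n - 1)\<close> from the
  squares.\<close>

lemma row_eq:
  assumes "i < c"
  shows "row n c i = real c * (real c - 1) / 2 + (real n - 1) * (real c - 1) * (2 * real c - 1) / 6
    - real n * (real i * (real c - 1 - real i))"
  using assms unfolding row_def wt_def sum.distrib sum_distrib_left[symmetric] sum_abs_diff sum_sq_diff
  by (simp add: field_simps power2_eq_square)

lemma sum_row: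
  "(\<Sum>i<c. row n c i) = real c * (real c * (real c - 1) / 2 + (real n - 1) * (real c - 1) * (2 * real c - 1) / 6)
    - real n * ((real c - 2) * (real c - 1) * real c / 6)"
proof -
  \<comment> \<open>The range \<open>m\<close> and the constant \<open>K\<close> are kept apart so
    that induction on \<open>m\<close> applies.\<close>
  have "(\<Sum>i<m. real i * (K - real i)) = K * real m * (real m - 1) / 2
      - (real m - 1) * real m * (2 * real m - 1) / 6" for m K
    by (induction m) (simp_all add: field_simps)
  from this[where m = c and K = "real c - 1"]
  have "(\<Sum>i<c. real i * (real c - 1 - real i)) = (real c - 2) * (real c - 1) * real c / 6"
    by (simp add: field_simps)
  moreover have "(\<Sum>i<c. row n c i) = (\<Sum>i<c. (real c * (real c - 1) / 2
      + (real n - 1) * (real c - 1) * (2 * real c - 1) / 6) - real n * (real i * (real c - 1 - real i)))"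
    by (intro sum.cong refl) (simp add: row_eq)
  ultimately show ?thesis by (simp add: sum_subtractf flip: sum_distrib_left)
qed

text \<open>Indices start at zero, so \<open>(c - 1) div 2\<close> and \<open>c div 2\<close> are
  the two middle positions, which coincide for odd \<open>c\<close>.\<close>

abbreviation rowmin :: "nat \<Rightarrow> nat \<Rightarrow> real" where
  "rowmin n c \<equiv> row n c ((c - 1) div 2)"

text \<open>The difference to the minimum is \<open>n\<close> times the product of the signed
  distances from \<open>i\<close> to the two middle positions. These are equal or consecutive, so no
  integer lies strictly between them and the product is nonnegative.\<close>

lemma row_minimal:
  assumes i: "i < c" and n: "0 < n"
  shows "rowmin n c \<le> row n c i"
    and "row n c i = rowmin n c \<longleftrightarrow> i = (c - 1) div 2 \<or> i = c div 2"
proof -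
  define k where "k = (c - 1) div 2"
  have k: "k < c" "c - 1 - k = c div 2" using i by (auto simp: k_def)
  have ck: "real c - 1 - real k = real (c div 2)" using k by linarith
  have diff: "row n c i - rowmin n c = real n * ((real k - real i) * (real (c div 2) - real i))"
    unfolding k_def[symmetric] row_eq[OF i] row_eq[OF k(1)] ck[symmetric] by (simp add: algebra_simps)
  have "(real k - real i) * (real (c div 2) - real i) \<ge> 0"
  proof (cases "i \<le> k")
    case True
    moreover have "k \<le> c div 2" by (simp add: k_def div_le_mono)
    ultimately show ?thesis by simp
  next
    case False
    moreover have "c div 2 \<le> Suc k" by (auto simp: k_def)
    ultimately show ?thesis by (intro mult_nonpos_nonpos) auto
  qed
  then show "rowmin n c \<le> row n c i" using diff by (smt (verit) mult_nonneg_nonneg of_nat_0_le_iff)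
  show "row n c i = rowmin n c \<longleftrightarrow> i = (c - 1) div 2 \<or> i = c div 2"
    using diff n unfolding k_def[symmetric] by auto
qed

text \<open>The value of \<^const>\<open>excess\<close> for a pendant path with \<open>t\<close> edges at a middle vertex.\<close>

definition bnd :: "nat \<Rightarrow> nat \<Rightarrow> nat \<Rightarrow> real" where
  "bnd n c t = 2 / 3 * (real t - 1) * real t * (real t + 1) - 2 * real t * rowmin n c - (\<Sum>i<c. row n c i)"

lemma bnd_Suc: "bnd n c (Suc t) = bnd n c t + 2 * (real t * (real t + 1)) - 2 * rowmin n c"
  by (simp add: bnd_def field_simps)

lemma wt_commute: "wt n c i j = wt n c j i"
  by (simp add: wt_def abs_minus_commute power2_commute)

lemma wt_self [simp]: "wt n c i i = 0"
  by (simp add: wt_def)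

lemma wt_nonneg: "0 < n \<Longrightarrow> wt n c i j \<ge> 0"
  by (simp add: wt_def)

lemma wt_pos: "0 < n \<Longrightarrow> i \<noteq> j \<Longrightarrow> wt n c i j > 0"
  by (simp add: wt_def add_pos_nonneg)

section \<open>The leafwise bound on the excess and its equality case\<close>

context
  fixes ps :: "'a list" and n c :: nat
  assumes ne: "ps \<noteq> []" and distinct: "distinct ps" and c: "length ps = c" and n: "0 < n"
begin

lemma c_pos: "0 < c"
  using ne c by auto

lemma sum_path:
  assumes "grown ps V E b a"
  shows "(\<Sum>z\<in>set ps. g (b z)) = (\<Sum>i<c. g i)"
proof -
  have "bij_betw ((!) ps) {..<c} (set ps)"
    using distinct c by (intro bij_betw_nth) auto
  then have "(\<Sum>z\<in>set ps. g (b z)) = (\<Sum>i<c. g (b (ps ! i)))"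
    by (rule sum.reindex_bij_betw[symmetric])
  also have "\<dots> = (\<Sum>i<c. g i)"
    using grown_sets(4)[OF ne distinct assms] c by (intro sum.cong) auto
  finally show ?thesis .
qed

lemma excess_path:
  assumes "grown ps (set ps) (path_edges ps) b (\<lambda>_ _. 0)"
  shows "excess (set ps) n c b (\<lambda>_ _. 0) = bnd n c 0"
  by (simp add: excess_def bnd_def row_def sum_path[OF assms] sum_path[OF assms, of "\<lambda>i. \<Sum>j<c. wt n c i j"])

text \<open>The new row and the new column each contribute the sums for \<open>y\<close>. The new
  diagonal entry of \<open>attach\<close> is removed again by the diagonal term of
  \<open>excess\<close>, and that of \<open>wt\<close> is zero.\<close>

lemma excess_attach:
  assumes g: "grown ps V E b a" and x: "x \<notin> V" and y: "y \<in> V"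
  shows "excess (insert x V) n c (b(x := b y)) (attach a x y) = excess V n c b a
    + 4 * (\<Sum>z\<in>V. real (a y z)) - 2 * (\<Sum>z\<in>V. wt n c (b y) (b z))"
proof -
  have fin: "finite V" using grown_sets(2)[OF ne distinct g] .
  have ins: "(\<Sum>u\<in>insert x V. \<Sum>v\<in>insert x V. h u v)
      = h x x + (\<Sum>v\<in>V. h x v) + (\<Sum>u\<in>V. h u x) + (\<Sum>u\<in>V. \<Sum>v\<in>V. h u v)" for h :: "'a \<Rightarrow> 'a \<Rightarrow> real"
    using fin x by (simp add: sum.distrib)
  let ?b = "b(x := b y)" and ?a = "attach a x y"
  have b: "(\<Sum>u\<in>V. h (?b u)) = (\<Sum>u\<in>V. h (b u))" for h :: "nat \<Rightarrow> real"
    using x by (intro sum.cong) auto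
  have bb: "(\<Sum>u\<in>V. \<Sum>v\<in>V. wt n c (?b u) (?b v)) = (\<Sum>u\<in>V. \<Sum>v\<in>V. wt n c (b u) (b v))"
    unfolding b by (rule b)
  have bx: "(\<Sum>u\<in>V. wt n c (?b u) (b y)) = (\<Sum>u\<in>V. wt n c (b y) (b u))"
    unfolding b[of "\<lambda>i. wt n c i (b y)"] by (intro sum.cong refl) (rule wt_commute)
  have aa: "(\<Sum>u\<in>V. \<Sum>v\<in>V. real (?a u v)) = (\<Sum>u\<in>V. \<Sum>v\<in>V. real (a u v))"
    using x by (intro sum.cong refl) (auto simp: attach_def)
  have a1: "(\<Sum>v\<in>V. real (?a x v)) = (\<Sum>v\<in>V. real (a y v))"
    using x by (intro sum.cong refl) (auto simp: attach_def)
  have a2: "(\<Sum>u\<in>V. real (?a u x)) = (\<Sum>v\<in>V. real (a y v))"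
  proof (intro sum.cong refl)
    fix u assume u: "u \<in> V"
    then have "?a u x = a u y" using x by (auto simp: attach_def)
    also have "\<dots> = a y u" using grown_ancestors(1)[OF ne distinct g u y] .
    finally show "real (?a u x) = real (a y u)" by simp
  qed
  have a3: "(\<Sum>u\<in>V. real (?a u u)) = (\<Sum>u\<in>V. real (a u u))"
    using x by (intro sum.cong refl) (auto simp: attach_def)
  have xs: "?b x = b y" "?a x x = Suc (a y y)" by (simp_all add: attach_def)
  show ?thesis
    unfolding excess_def ins
    unfolding aa a1 a2 bb sum.insert[OF fin x] a3 xs bx b[of "wt n c (b y)"] by simp
qed

text \<open>The leaf attached after \<open>t\<close> others has depth at most \<open>t + 1\<close>,
  and path vertices have depth zero.\<close>

lemma sum_depth_le:
  assumes "grown ps V E b a"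
  shows "(\<Sum>z\<in>V. real (a z z)) \<le> real (card V - c) * (real (card V - c) + 1) / 2"
  using assms
proof (induction rule: grown.induct)
  case (leaf V E b a x y)
  have fin: "finite V" and le: "c \<le> card V" using grown_sets[OF ne distinct leaf(1)] c by auto
  have card: "card (insert x V) - c = Suc (card V - c)" using fin le leaf(2) by simp
  have "a y y + c \<le> card V" using grown_ancestors(3)[OF ne distinct leaf(1,3)] c by simp
  then have y: "real (a y y) \<le> real (card V - c)" by linarith
  have "(\<Sum>z\<in>V. real (attach a x y z z)) = (\<Sum>z\<in>V. real (a z z))"
    using leaf(2) by (intro sum.cong refl) (auto simp: attach_def)
  then have "(\<Sum>z\<in>insert x V. real (attach a x y z z)) = (\<Sum>z\<in>V. real (a z z)) + real (a y y) + 1"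
    using fin leaf(2) by (simp add: attach_def)
  also have "\<dots> \<le> real (card V - c) * (real (card V - c) + 1) / 2 + real (card V - c) + 1"
    using leaf(4) y by simp
  finally show ?case unfolding card by (simp add: field_simps)
qed simp

text \<open>The ancestors that \<open>z\<close> shares with \<open>y\<close> are among the ancestors
  of \<open>z\<close>.\<close>

lemma sum_ancestors_le:
  assumes g: "grown ps V E b a" and y: "y \<in> V"
  shows "(\<Sum>z\<in>V. real (a y z)) \<le> real (card V - c) * (real (card V - c) + 1) / 2"
proof -
  have "(\<Sum>z\<in>V. real (a y z)) \<le> (\<Sum>z\<in>V. real (a z z))"
    using grown_ancestors(2)[OF ne distinct g y] by (intro sum_mono) simp
  then show ?thesis using sum_depth_le[OF g] by simp
qed

lemma sum_wt_eq:
  assumes g: "grown ps V E b a"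
  shows "(\<Sum>z\<in>V. wt n c i (b z)) = row n c i + (\<Sum>z\<in>V - set ps. wt n c i (b z))"
  using sum.subset_diff[OF grown_sets(1,2)[OF ne distinct g], of "\<lambda>z. wt n c i (b z)"]
  by (simp add: sum_path[OF g] row_def)

lemma rowmin_le_sum_wt:
  assumes g: "grown ps V E b a" and y: "y \<in> V"
  shows "rowmin n c \<le> (\<Sum>z\<in>V. wt n c (b y) (b z))"
proof -
  have "b y < c" using grown_sets(5)[OF ne distinct g y] c by simp
  then have "rowmin n c \<le> row n c (b y)" using n by (rule row_minimal)
  also have "\<dots> \<le> (\<Sum>z\<in>V. wt n c (b y) (b z))"
    unfolding sum_wt_eq[OF g] using wt_nonneg[OF n] by (simp add: sum_nonneg)
  finally show ?thesis .
qed

lemma excess_le: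
  assumes "grown ps V E b a"
  shows "excess V n c b a \<le> bnd n c (card V - c)"
  using assms
proof (induction rule: grown.induct)
  case (path b)
  then have "grown ps (set ps) (path_edges ps) b (\<lambda>_ _. 0)" by (rule grown.path)
  then show ?case using distinct c by (simp add: excess_path distinct_card)
next
  case (leaf V E b a x y)
  have fin: "finite V" and le: "c \<le> card V" using grown_sets[OF ne distinct leaf(1)] c by auto
  have card: "card (insert x V) - c = Suc (card V - c)" using fin le leaf(2) by simp
  show ?case
    unfolding card bnd_Suc excess_attach[OF leaf(1-3)]
    using leaf(4) sum_ancestors_le[OF leaf(1,3)] rowmin_le_sum_wt[OF leaf(1,3)] by linarith
qed

text \<open>The list \<open>us\<close> is the pendant path together with its attaching vertex on
  \<open>ps\<close>. So the position in \<open>us\<close> is the depth, and two vertices of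
  \<open>us\<close> share the ancestors of the shallower one. Without vertices off the path
  \<open>us\<close> is a singleton.\<close>

definition pathlike ::
  "'a set \<Rightarrow> 'a set set \<Rightarrow> ('a \<Rightarrow> nat) \<Rightarrow> ('a \<Rightarrow> 'a \<Rightarrow> nat) \<Rightarrow> 'a list \<Rightarrow> nat \<Rightarrow> bool" where
  "pathlike V E b a us m \<longleftrightarrow> length us = card V - c + 1 \<and> hd us = ps ! m \<and> m < c \<and>
     distinct (ps @ tl us) \<and> V = set ps \<union> set us \<and> E = path_edges ps \<union> path_edges us \<and>
     (\<forall>i<length us. b (us ! i) = m) \<and>
     (\<forall>i<length us. \<forall>j<length us. a (us ! i) (us ! j) = min i j)"

lemma pathlike_path:
  assumes g: "grown ps (set ps) (path_edges ps) b (\<lambda>_ _. 0)" and m: "m < c"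
  shows "pathlike (set ps) (path_edges ps) b (\<lambda>_ _. 0) [ps ! m] m"
  using m c distinct grown_sets(4)[OF ne distinct g]
  by (auto simp: pathlike_def distinct_card)

lemma pathlike_distinct:
  assumes "pathlike V E b a us m"
  shows "us \<noteq> []" and "distinct us"
proof -
  show "us \<noteq> []" using assms by (auto simp: pathlike_def)
  then obtain u us' where us: "us = u # us'" by (cases us) auto
  then have "u \<in> set ps" using assms c by (auto simp: pathlike_def)
  then show "distinct us" using assms us by (auto simp: pathlike_def)
qed

lemma pathlike_snoc:
  assumes p: "pathlike V E b a us m" and g: "grown ps V E b a" and x: "x \<notin> V"
  shows "pathlike (insert x V) (insert {x, last us} E) (b(x := b (last us)))
    (attach a x (last us)) (us @ [x]) m"
proof -
  note us = pathlike_distinct[OF p]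
  have fin: "finite V" and le: "c \<le> card V" using grown_sets[OF ne distinct g] c by auto
  have card: "card (insert x V) - c = Suc (card V - c)" using fin le x by simp
  define t where "t = length us - 1"
  have t: "length us = Suc t" "last us = us ! t" using us by (auto simp: t_def last_conv_nth)
  have neq: "us ! i \<noteq> x" if "i < length us" for i
    using x p nth_mem[OF that] by (auto simp: pathlike_def)
  have ab: "b (us ! i) = m" "a (us ! i) (us ! j) = min i j" if "i < length us" "j < length us" for i j
    using p that unfolding pathlike_def by blast+
  have old: "(us @ [x]) ! i = us ! i \<and> us ! i \<noteq> x" if "i < length (us @ [x])" "i \<noteq> length us" for i
  proof -
    have "i < length us" using that by simp
    then show ?thesis using neq by (simp add: nth_append)
  qed
  have new: "(us @ [x]) ! length us = x" by simp
  have "attach a x (last us) ((us @ [x]) ! i) ((us @ [x]) ! j) = min i j"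
    if i: "i < length (us @ [x])" and j: "j < length (us @ [x])" for i j
  proof -
    have it: "i \<le> t" if "i \<noteq> length us" using that i t by simp
    have jt: "j \<le> t" if "j \<noteq> length us" using that j t by simp
    consider "i = length us" "j = length us" | "i = length us" "j \<noteq> length us"
      | "i \<noteq> length us" "j = length us" | "i \<noteq> length us" "j \<noteq> length us" by blast
    then show ?thesis
    proof cases
      case 1
      then show ?thesis using ab(2)[of t t] t new by (simp add: attach_def)
    next
      case 2
      then show ?thesis using ab(2)[of t j] t new old[OF j] jt by (simp add: attach_def)
    next
      case 3
      then show ?thesis using ab(2)[of i t] t new old[OF i] it by (simp add: attach_def)
    next
      case 4
      then show ?thesis using ab(2)[of i j] t old[OF i] old[OF j] it jt by (simp add: attach_def)
    qed
  qed
  moreover have "(b(x := b (last us))) ((us @ [x]) ! i) = m" if i: "i < length (us @ [x])" for i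
    using ab(1)[of i i] ab(1)[of t t] t new old[OF i] i by (cases "i = length us") auto
  moreover have "E = path_edges ps \<union> path_edges us" "V = set ps \<union> set us" "distinct (ps @ tl us)"
    "hd us = ps ! m" "m < c" "length us = card V - c + 1"
    using p by (auto simp: pathlike_def)
  ultimately show ?thesis
    using x us unfolding pathlike_def card by (auto simp: path_edges_snoc dest: list.set_sel(2))
qed

text \<open>All vertices off the path are ancestors of the last one, which therefore attains the
  bound of \<open>sum_ancestors_le\<close>; the depths attain theirs as well.\<close>

lemma pathlike_sum_ancestors:
  assumes p: "pathlike V E b a us m" and g: "grown ps V E b a"
  shows "(\<Sum>z\<in>V. real (a (last us) z)) = real (card V - c) * (real (card V - c) + 1) / 2"
    and "(\<Sum>z\<in>V. real (a z z)) = real (card V - c) * (real (card V - c) + 1) / 2"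
proof -
  note us = pathlike_distinct[OF p]
  define t where "t = length us - 1"
  have t: "length us = Suc t" "last us = us ! t" using us by (auto simp: t_def last_conv_nth)
  have tV: "card V - c = t" using p t by (simp add: pathlike_def)
  have fin: "finite V" using grown_sets[OF ne distinct g] by blast
  have V: "V = set ps \<union> set us" using p by (simp add: pathlike_def)
  have lastV: "last us \<in> V" using us V by simp
  have a: "a (us ! i) (us ! j) = min i j" if "i < length us" "j < length us" for i j
    using p that unfolding pathlike_def by blast
  have sum: "(\<Sum>z\<in>V. h z) = (\<Sum>j<Suc t. h (us ! j))" if "\<And>z. z \<in> set ps \<Longrightarrow> h z = 0" for h :: "'a \<Rightarrow> real"
  proof -
    have "(\<Sum>z\<in>V. h z) = (\<Sum>z\<in>set us. h z)"
      using fin V that by (intro sum.mono_neutral_right) auto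
    also have "\<dots> = (\<Sum>j<Suc t. h (us ! j))"
      using us t by (intro sum.reindex_bij_betw[symmetric] bij_betw_nth) auto
    finally show ?thesis .
  qed
  have tri: "(\<Sum>j<Suc t. real j) = real t * (real t + 1) / 2" for t
    by (induction t) (simp_all add: field_simps)
  have anc0: "a v z = 0" if "z \<in> set ps" "v \<in> V" for z v
    using grown_ancestors(4)[OF ne distinct g that] .
  have "(\<Sum>z\<in>V. real (a (last us) z)) = (\<Sum>j<Suc t. real (a (last us) (us ! j)))"
    using anc0 lastV by (intro sum) simp
  also have "\<dots> = (\<Sum>j<Suc t. real j)"
    unfolding t(2) using a t(1) by (intro sum.cong refl) simp
  finally show "(\<Sum>z\<in>V. real (a (last us) z)) = real (card V - c) * (real (card V - c) + 1) / 2"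
    unfolding tri tV .
  have "(\<Sum>z\<in>V. real (a z z)) = (\<Sum>j<Suc t. real (a (us ! j) (us ! j)))"
    using anc0 V by (intro sum) simp
  also have "\<dots> = (\<Sum>j<Suc t. real j)"
    using a t(1) by (intro sum.cong refl) simp
  finally show "(\<Sum>z\<in>V. real (a z z)) = real (card V - c) * (real (card V - c) + 1) / 2"
    unfolding tri tV .
qed

lemma pathlike_branch:
  assumes p: "pathlike V E b a us m" and z: "z \<in> set us"
  shows "b z = m"
proof -
  obtain i where "i < length us" "z = us ! i" using z by (metis in_set_conv_nth)
  then show ?thesis using p unfolding pathlike_def by blast
qed

lemma pathlike_sum_wt:
  assumes p: "pathlike V E b a us m" and g: "grown ps V E b a"
  shows "(\<Sum>z\<in>V. wt n c m (b z)) = row n c m"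
proof -
  have "V - set ps \<subseteq> set us" using p by (auto simp: pathlike_def)
  then have "(\<Sum>z\<in>V - set ps. wt n c m (b z)) = 0"
    using pathlike_branch[OF p] by (intro sum.neutral) auto
  then show ?thesis unfolding sum_wt_eq[OF g] by simp
qed

abbreviation (input) middle :: "nat \<Rightarrow> bool" where
  "middle m \<equiv> m = (c - 1) div 2 \<or> m = c div 2"

text \<open>Grown outwards from the attaching vertex, the pendant path meets both step bounds with
  equality: each leaf goes to the deepest vertex, and the vertices off the path lie in its own
  branch, where the weight vanishes.\<close>

lemma exists_pathlike:
  assumes "us \<noteq> []" "hd us = ps ! m" "distinct (ps @ tl us)" "middle m"
  shows "\<exists>b a. grown ps (set ps \<union> set us) (path_edges ps \<union> path_edges us) b a \<and>
    pathlike (set ps \<union> set us) (path_edges ps \<union> path_edges us) b a us m \<and>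
    excess (set ps \<union> set us) n c b a = bnd n c (length us - 1)"
  using assms(1-3)
proof (induction us rule: rev_induct)
  case (snoc x us)
  have m: "m < c" using assms(4) c_pos by auto
  show ?case
  proof (cases "us = []")
    case True
    obtain b where "\<forall>i<length ps. b (ps ! i) = i" using distinct_index[OF distinct] ..
    then have g: "grown ps (set ps) (path_edges ps) b (\<lambda>_ _. 0)" by (simp add: grown.path)
    moreover have x: "x = ps ! m" "insert x (set ps) = set ps"
      using True snoc.prems m c by auto
    ultimately show ?thesis
      using pathlike_path[OF g m] excess_path[OF g] True by auto
  next
    case False
    then have "hd us = ps ! m" "distinct (ps @ tl us)" using snoc.prems by auto
    with snoc.IH[OF False] obtain b a where
      g: "grown ps (set ps \<union> set us) (path_edges ps \<union> path_edges us) b a" and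
      p: "pathlike (set ps \<union> set us) (path_edges ps \<union> path_edges us) b a us m" and
      e: "excess (set ps \<union> set us) n c b a = bnd n c (length us - 1)" by blast
    have "set us = insert (hd us) (set (tl us))" using False by (cases us) auto
    then have x: "x \<notin> set ps \<union> set us"
      using snoc.prems False m c by auto
    have last: "last us \<in> set ps \<union> set us" using False by simp
    have V: "set ps \<union> set (us @ [x]) = insert x (set ps \<union> set us)" by auto
    have E: "path_edges ps \<union> path_edges (us @ [x]) = insert {x, last us} (path_edges ps \<union> path_edges us)"
      using False by (auto simp: path_edges_snoc)
    have "b (last us) = m" using pathlike_branch[OF p] False by simp
    then have wt: "(\<Sum>z\<in>set ps \<union> set us. wt n c (b (last us)) (b z)) = rowmin n c"
      using pathlike_sum_wt[OF p g] row_minimal(2)[OF m n] assms(4) by simp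
    have card: "card (set ps \<union> set us) - c = length us - 1"
      using p by (simp add: pathlike_def)
    have len: "length (us @ [x]) - 1 = Suc (length us - 1)" using False by simp
    have "excess (insert x (set ps \<union> set us)) n c (b(x := b (last us))) (attach a x (last us))
        = bnd n c (length (us @ [x]) - 1)"
      unfolding excess_attach[OF g x last] e wt pathlike_sum_ancestors(1)[OF p g] card len bnd_Suc by simp
    then show ?thesis
      unfolding V E using grown.leaf[OF g x last] pathlike_snoc[OF p g x] by blast
  qed
qed simp

text \<open>Equality at the end forces equality in every step. So the tree before the last leaf is
  already of the required form, and it remains to see that the leaf sits at the end of the pendant
  path.\<close>

lemma excess_eq_imp_pathlike:
  assumes "grown ps V E b a" "excess V n c b a = bnd n c (card V - c)"
  shows "\<exists>us m. middle m \<and> pathlike V E b a us m"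
  using assms
proof (induction rule: grown.induct)
  case (path b)
  then have g: "grown ps (set ps) (path_edges ps) b (\<lambda>_ _. 0)" by (simp add: grown.path)
  have "c div 2 < c" using c_pos by simp
  then show ?case using pathlike_path[OF g] by blast
next
  case (leaf V E b a x y)
  note g = leaf(1)
  have fin: "finite V" and le: "c \<le> card V" using grown_sets[OF ne distinct g] c by auto
  have card: "card (insert x V) - c = Suc (card V - c)" using fin le leaf(2) by simp
  define t where "t = card V - c"
  have eq: "excess V n c b a + 4 * (\<Sum>z\<in>V. real (a y z)) - 2 * (\<Sum>z\<in>V. wt n c (b y) (b z))
      = bnd n c t + 2 * (real t * (real t + 1)) - 2 * rowmin n c"
    using leaf(5) unfolding card bnd_Suc excess_attach[OF leaf(1-3)] t_def .
  have "excess V n c b a \<le> bnd n c t" and "(\<Sum>z\<in>V. real (a y z)) \<le> real t * (real t + 1) / 2"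
    and "rowmin n c \<le> (\<Sum>z\<in>V. wt n c (b y) (b z))"
    unfolding t_def using excess_le[OF g] sum_ancestors_le[OF g leaf(3)] rowmin_le_sum_wt[OF g leaf(3)] .
  then have exc: "excess V n c b a = bnd n c t"
    and anc: "(\<Sum>z\<in>V. real (a y z)) = real t * (real t + 1) / 2"
    and wt: "(\<Sum>z\<in>V. wt n c (b y) (b z)) = rowmin n c"
    using eq by linarith+
  obtain us m where m: "middle m" and p: "pathlike V E b a us m"
    using leaf(4) exc t_def by blast
  note us = pathlike_distinct[OF p]
  have V: "V = set ps \<union> set us" and E: "E = path_edges ps \<union> path_edges us"
    and len: "length us = Suc t" using p by (auto simp: pathlike_def t_def)
  have byc: "b y < c" using grown_sets(5)[OF ne distinct g leaf(3)] c by simp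
  have row: "row n c (b y) \<ge> rowmin n c" using byc n by (rule row_minimal)
  \<comment> \<open>The list may have to be replaced: with no vertex off the path it is a single
    middle vertex, which for even \<open>c\<close> need not be \<open>y\<close>.\<close>
  have "\<exists>us m. middle m \<and> pathlike V E b a us m \<and> last us = y"
  proof (cases "t = 0")
    case True
    then obtain u where u: "us = [u]" using len by (auto simp: length_Suc_conv)
    then have uy: "u \<in> set ps" using p c by (auto simp: pathlike_def)
    then have Vps: "V = set ps" and Eps: "E = path_edges ps" using V E u by auto
    have "row n c (b y) = rowmin n c"
      using wt unfolding sum_wt_eq[OF g] using Vps by simp
    then have mid: "middle (b y)" using row_minimal(2)[OF byc n] by simp
    have "y \<in> set ps" using leaf(3) Vps by simp
    then obtain i where "i < length ps" "y = ps ! i" by (metis in_set_conv_nth)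
    then have "ps ! b y = y" using grown_sets(4)[OF ne distinct g] by simp
    moreover have "a y y = 0" using grown_ancestors(4)[OF ne distinct g \<open>y \<in> set ps\<close> leaf(3)] .
    ultimately have "pathlike V E b a [y] (b y)"
      using byc Vps Eps distinct c \<open>y \<in> set ps\<close> by (auto simp: pathlike_def distinct_card)
    then show ?thesis using mid by (intro exI[of _ "[y]"] exI[of _ "b y"]) simp
  next
    case False
    have last: "last us = us ! t" using us len by (simp add: last_conv_nth)
    have lastV: "last us \<in> V" using us V by simp
    have "last us \<notin> set ps"
    proof -
      have "last us \<in> set (tl us)" using len False us by (cases us) auto
      then show ?thesis using p by (auto simp: pathlike_def)
    qed
    then have lastW: "last us \<in> V - set ps" using lastV by simp
    \<comment> \<open>The path alone already contributes \<open>rowmin\<close>, so vertices off the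
      path must have weight zero and lie in the branch of \<open>y\<close>.\<close>
    have "wt n c (b y) (b (last us)) \<le> (\<Sum>z\<in>V - set ps. wt n c (b y) (b z))"
      using fin lastW wt_nonneg[OF n] by (intro member_le_sum) auto
    then have "wt n c (b y) (b (last us)) \<le> 0"
      using wt row unfolding sum_wt_eq[OF g] by linarith
    then have bym: "b y = m"
      using wt_pos[OF n, of "b y" "b (last us)" c] pathlike_branch[OF p, of "last us"] us(1)
      by (cases "b y = b (last us)") auto
    have "y \<in> set us"
    proof (cases "y \<in> set ps")
      case True
      then obtain i where "i < length ps" "y = ps ! i" by (metis in_set_conv_nth)
      then have "y = ps ! m" using grown_sets(4)[OF ne distinct g] bym by simp
      then have "y = hd us" using p by (simp add: pathlike_def)
      then show ?thesis using us by simp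
    qed (use leaf(3) V in simp)
    then obtain i where i: "i < length us" "y = us ! i" by (metis in_set_conv_nth)
    \<comment> \<open>Equality of the two sums makes every nonnegative difference vanish. At the
      last vertex of \<open>us\<close>, of depth \<open>t\<close>, this forces \<open>y\<close> to
      have depth \<open>t\<close> as well.\<close>
    have "(\<Sum>z\<in>V. real (a z z) - real (a y z)) = 0"
      using pathlike_sum_ancestors(2)[OF p g] anc t_def by (simp add: sum_subtractf)
    moreover have "real (a z z) - real (a y z) \<ge> 0" if "z \<in> V" for z
      using grown_ancestors(2)[OF ne distinct g leaf(3) that] by simp
    ultimately have "real (a (last us) (last us)) - real (a y (last us)) = 0"
      using sum_nonneg_eq_0_iff[OF fin, of "\<lambda>z. real (a z z) - real (a y z)"] lastV by blast
    moreover have "a (last us) (last us) = t" "a y (last us) = min i t"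
      using p i len unfolding last pathlike_def by auto
    ultimately have "i = t" using i len by simp
    then have "last us = y" using i last by simp
    then show ?thesis using m p by blast
  qed
  then obtain us' m' where "middle m'" "pathlike V E b a us' m'" "last us' = y" by blast
  then show ?case using pathlike_snoc[OF _ g leaf(2)] by blast
qed

end

text \<open>With \<open>k\<close> the lower middle position,
  \<open>k * (c - 1 - k) = (k + 1) * (c - k) - c\<close>; this is how the minimal row produces the
  product of floor and ceiling.\<close>

lemma bnd_closed_form:
  assumes "0 < c" "c \<le> n" "2 \<le> n"
  shows "bnd n c (n - c)
    + (real n - 1) * (4 * real n * (real c - 1) - 4 * (real n - 1) + 2 * (real c - 1)
       - 2 * real n * (real n - 1) - 2 * (real n - 1)\<^sup>2) / 4
    + real n * (2 * real n * (real n - 1) + 2 * (real n - 1)\<^sup>2) / 4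
    = real n * (real n - 1) * (1 / (4 * real c * real n * (real n - 1)) *
        (4 * real c * (2/3) * (real n - real c + 1) * (real n - real c) * (real n - real c - 1)
         - 8 * (real n - real c) *
             (- real n * real c * real ((c + 1) div 2) * real ((c + 2) div 2)
              + real c * (real c + 1) / 6 * ((2 * real n + 1) * real c + real n - 1))
         - 4 * (real n + 1) * (real c)^2 * ((real c)^2 - 1) / 6
         + 4 * real n * (real n - 1) * real c * (real c - 1)
         + 2 * (real n - 1) * (real c)^2))"
proof -
  define k where "k = (c - 1) div 2"
  have k: "k < c" using assms by (auto simp: k_def)
  \<comment> \<open>The two integer quotients are the floor and the ceiling of half of
    \<open>c + 1\<close>.\<close>
  have halves: "real ((c + 1) div 2) = real k + 1" "real ((c + 2) div 2) = real c - real k"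
  proof -
    have "(c + 1) div 2 = k + 1" "(c + 2) div 2 + k = c" using assms(1) by (auto simp: k_def)
    then show "real ((c + 1) div 2) = real k + 1" "real ((c + 2) div 2) = real c - real k"
      by linarith+
  qed
  have nc: "real (n - c) = real n - real c" using assms by simp
  have pos: "real c \<noteq> 0" "real n \<noteq> 0" "real n - 1 \<noteq> 0" using assms by auto
  show ?thesis
    unfolding bnd_def k_def[symmetric] row_eq[OF k] sum_row nc mult.assoc halves
    using pos by (simp add: field_simps power2_eq_square)
qed

theorem theorem3p1:
  fixes V :: "'a set" and E :: "'a set set" and ps :: "'a list" and n c :: nat
  assumes "tree V E"
    and "card V = n" and "n \<ge> 4"
    and "is_path V E ps" and "length ps = c"
    and "hd ps \<noteq> last ps" and "\<not> adj E (hd ps) (last ps)"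
  shows "kemeny V (insert {hd ps, last ps} E) - kemeny V E
      \<le> 1 / (4 * real c * real n * (real n - 1)) *
        (4 * real c * (2/3) * (real n - real c + 1) * (real n - real c) * (real n - real c - 1)
         - 8 * (real n - real c) *
             (- real n * real c * real ((c + 1) div 2) * real ((c + 2) div 2)
              + real c * (real c + 1) / 6 * ((2 * real n + 1) * real c + real n - 1))
         - 4 * (real n + 1) * (real c)^2 * ((real c)^2 - 1) / 6
         + 4 * real n * (real n - 1) * real c * (real c - 1)
         + 2 * (real n - 1) * (real c)^2)
    \<and> (kemeny V (insert {hd ps, last ps} E) - kemeny V E
      = 1 / (4 * real c * real n * (real n - 1)) *
        (4 * real c * (2/3) * (real n - real c + 1) * (real n - real c) * (real n - real c - 1)
         - 8 * (real n - real c) *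
             (- real n * real c * real ((c + 1) div 2) * real ((c + 2) div 2)
              + real c * (real c + 1) / 6 * ((2 * real n + 1) * real c + real n - 1))
         - 4 * (real n + 1) * (real c)^2 * ((real c)^2 - 1) / 6
         + 4 * real n * (real n - 1) * real c * (real c - 1)
         + 2 * (real n - 1) * (real c)^2)
      \<longleftrightarrow> (\<exists>m us. (m = (c - 1) div 2 \<or> m = c div 2) \<and>
             length us = n - c + 1 \<and> hd us = ps ! m \<and> set us \<subseteq> V \<and>
             distinct (ps @ tl us) \<and> E = path_edges ps \<union> path_edges us))"
    (is "?K \<le> ?B \<and> (?K = ?B \<longleftrightarrow> ?extremal)")
proof -
  have ne: "ps \<noteq> []" and distinct: "distinct ps" and sub: "set ps \<subseteq> V"
    using assms(4) by (auto simp: is_path_def)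
  have fin: "finite V" using assms(1) by (simp add: tree_def simple_graph_def)
  have c2: "2 \<le> c"
  proof (rule ccontr)
    assume "\<not> 2 \<le> c"
    then have "length ps = 1" using ne assms(5) by (cases ps) auto
    then show False using assms(6) by (auto simp: length_Suc_conv)
  qed
  have cn: "c \<le> n"
    using card_mono[OF fin sub] distinct_card[OF distinct] assms(2,5) by simp
  have pos: "0 < real n * (real n - 1)" using assms(3) by simp
  have n0: "0 < n" and n2: "2 \<le> n" using assms(3) by auto
  \<comment> \<open>Scaling by the positive factor \<open>n * (n - 1)\<close> reduces both claims to
    \<open>excess\<close> against \<open>bnd\<close>. This holds for every way of growing the
    tree.\<close>
  have key: "real n * (real n - 1) * (?K - ?B) = excess V n c b a - bnd n c (n - c)"
    if g: "grown ps V E b a" for b a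
    using kemeny_diff[OF ne distinct g assms(2)[symmetric] assms(5)[symmetric] c2 refl refl assms(7)]
      bnd_closed_form[OF _ cn n2] c2
    unfolding right_diff_distrib[of _ ?K ?B] by linarith
  obtain b a where g: "grown ps V E b a" using assms(1,4) by (rule tree_grown)
  have "excess V n c b a \<le> bnd n c (n - c)"
    using excess_le[OF ne distinct assms(5) n0 g] assms(2) by simp
  then have "real n * (real n - 1) * (?K - ?B) \<le> 0" using key[OF g] by linarith
  then have "?K - ?B \<le> 0" using mult_le_cancel_left_pos[OF pos, of "?K - ?B" 0] by linarith
  then have "?K \<le> ?B" by linarith
  moreover have "?extremal" if "?K = ?B"
  proof -
    have "excess V n c b a = bnd n c (card V - c)" using key[OF g] that assms(2) by simp
    then obtain us m where m: "m = (c - 1) div 2 \<or> m = c div 2" and p: "pathlike ps c V E b a us m"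
      using excess_eq_imp_pathlike[OF ne distinct assms(5) n0 g] by blast
    then have "length us = n - c + 1" "hd us = ps ! m" "set us \<subseteq> V" "distinct (ps @ tl us)"
      "E = path_edges ps \<union> path_edges us"
      using assms(2) pathlike_def[OF ne distinct assms(5) n0] by blast+
    with m show ?thesis by blast
  qed
  moreover have "?K = ?B" if ext: ?extremal
  proof -
    obtain m us where m: "m = (c - 1) div 2 \<or> m = c div 2" and len: "length us = n - c + 1"
      and hd: "hd us = ps ! m" and us: "set us \<subseteq> V" and dist: "distinct (ps @ tl us)"
      and E: "E = path_edges ps \<union> path_edges us" using ext by blast
    have us_ne: "us \<noteq> []" using len by auto
    \<comment> \<open>The two lists contain \<open>c + (n - c) = n\<close> distinct vertices and
      thus exhaust \<open>V\<close>.\<close>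
    have "set ps \<union> set (tl us) \<subseteq> V" using sub us us_ne by (auto dest: list.set_sel(2))
    moreover have "card (set ps \<union> set (tl us)) = n"
      using distinct_card[OF dist] len assms(5) cn by simp
    ultimately have V: "V = set ps \<union> set (tl us)"
      using fin assms(2) by (metis card_subset_eq)
    then have V: "V = set ps \<union> set us" using us us_ne sub by (auto dest: list.set_sel(2))
    \<comment> \<open>This growth need not be the one fixed before, but \<open>key\<close> applies
      to it too.\<close>
    obtain b' a' where "grown ps V E b' a'" "excess V n c b' a' = bnd n c (length us - 1)"
      using exists_pathlike[OF ne distinct assms(5) n0 us_ne hd dist m] unfolding V E by blast
    then have "real n * (real n - 1) * (?K - ?B) = 0" using key[of b' a'] len by simp
    then have "?K - ?B = 0" using pos by (metis less_irrefl mult_eq_0_iff)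
    then show ?thesis by linarith
  qed
  ultimately show ?thesis by blast
qed

end
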